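(* Let $S=\{S_n\}_{n\ge 0}$ be an increasing filtration of finite algebras on the standard probability space $\Omega$ that differentiates $L_1$ and grows uniformly. Let $\alpha^1,\alpha^2,\dots,\alpha^\ell$ be bounded periodic real sequences (indexed by $n\ge 0$). Then there exists a constant $C$ such that $$\|T_{\alpha^1}f\|_{L_1}\le C\sum_{j=2}^{\ell}\|T_{\alpha^j}f\|_{L_1}$$ for every $L_1$ martingale $f$ adapted to $\{S_n\}_n$ if and only if $\alpha^1$ is a linear combination of $\alpha^2,\dots,\alpha^\ell$.
   Context: Each $S_n$ is a finite algebra of measurable sets (generated by a finite partition of $\Omega$ into atoms), and $S_n\subset S_{n+1}$. The filtration differentiates $L_1$ if for every $f\in L_1(\Omega)$ the sequence $\mathbb{E}(f\mid S_n)$ tends to $f$ almost surely. The filtration grows uniformly if there exists $\gamma<1$ such that, for every $n$, each atom $a$ of $S_n$ is split in $S_{n+1}$ into atoms of probability not greater than $\gamma|a|$ each, where $|a|$ is the probability of $a$. For a bounded sequence $\alpha=\{\alpha_n\}_{n\ge0}$ the martingale transform $T_\alpha$ of a (real-valued) $L_1$ martingale $f=\{f_n\}_{n\ge 0}$ adapted to $\{S_n\}$ is $$T_\alpha[f]=\sum_{j=1}^{\infty}\alpha_{j-1}(f_j-f_{j-1}),$$ understood as the martingale of its partial sums $\sum_{j=1}^{n}\alpha_{j-1}(f_j-f_{j-1})$; the $L_1$-norm of a martingale is the supremum over $n$ of the $L_1$-norms of its members (possibly $+\infty$). A sequence $\alpha$ is periodic if there is $m\ge1$ with $\alpha_{n+m}=\alpha_n$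 for all $n\ge 0$. *)

theory Defs
  imports "HOL-Probability.Probability"
begin

text \<open>
  Standard (Lebesgue--Rokhlin) probability spaces: isomorphic modulo null sets to a Borel probability
  measure on the real line. Both sides are completed, so that standard Borel probability spaces as
  well as their completions qualify. The measure on the line may have point masses; a filtration
  that grows uniformly can exist only if the space is atomless, in which case it is isomorphic
  modulo null sets to the unit interval with Lebesgue measure.
\<close>

definition standard_prob_space :: "'a measure \<Rightarrow> bool" where
  "standard_prob_space M \<longleftrightarrow> prob_space M \<and>
     (\<exists>(\<mu> :: real measure) A B \<phi>.
        prob_space \<mu> \<and> sets \<mu> = sets borel \<and>
        A \<in> sets (completion M) \<and> emeasure (completion M) A = 1 \<and>
        B \<in> sets (completion \<mu>) \<and> emeasure (completion \<mu>) B = 1 \<and>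
        bij_betw \<phi> A B \<and>
        \<phi> \<in> restrict_space (completion M) A \<rightarrow>\<^sub>M restrict_space (completion \<mu>) B \<and>
        inv_into A \<phi> \<in> restrict_space (completion \<mu>) B \<rightarrow>\<^sub>M restrict_space (completion M) A \<and>
        distr (restrict_space (completion M) A) (restrict_space (completion \<mu>) B) \<phi>
          = restrict_space (completion \<mu>) B)"

text \<open>
  A finite algebra of measurable sets is a \<open>\<sigma>\<close>-algebra, so it is represented by a sub-\<open>\<sigma>\<close>-algebra
  with finitely many sets. Only the space and the sets of \<open>S n\<close> matter; probabilities are
  always taken with respect to \<open>M\<close>.
\<close>

definition finite_filtration :: "'a measure \<Rightarrow> (nat \<Rightarrow> 'a measure) \<Rightarrow> bool" where
  "finite_filtration M S \<longleftrightarrow>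
     filtration (space M) S \<and> (\<forall>n. subalgebra M (S n) \<and> finite (sets (S n)))"

text \<open>
  Atoms are understood set-theoretically (the cells of the partition generating the algebra);
  null cells are permitted.
\<close>

definition atoms_of :: "'a measure \<Rightarrow> 'a set set" where
  "atoms_of F = {a \<in> sets F. a \<noteq> {} \<and> (\<forall>b \<in> sets F. b \<subseteq> a \<longrightarrow> b = {} \<or> b = a)}"

definition differentiates_L1 :: "'a measure \<Rightarrow> (nat \<Rightarrow> 'a measure) \<Rightarrow> bool" where
  "differentiates_L1 M S \<longleftrightarrow>
     (\<forall>f :: 'a \<Rightarrow> real. integrable M f \<longrightarrow>
        (AE x in M. (\<lambda>n. real_cond_exp M (S n) f x) \<longlonglongrightarrow> f x))"

definition grows_uniformly :: "'a measure \<Rightarrow> (nat \<Rightarrow> 'a measure) \<Rightarrow> bool" where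
  "grows_uniformly M S \<longleftrightarrow>
     (\<exists>\<gamma> :: real. \<gamma> < 1 \<and>
        (\<forall>n. \<forall>a \<in> atoms_of (S n). \<forall>b \<in> atoms_of (S (Suc n)).
           b \<subseteq> a \<longrightarrow> measure M b \<le> \<gamma> * measure M a))"

definition martingale :: "'a measure \<Rightarrow> (nat \<Rightarrow> 'a measure) \<Rightarrow> (nat \<Rightarrow> 'a \<Rightarrow> real) \<Rightarrow> bool" where
  "martingale M S f \<longleftrightarrow>
     (\<forall>n. f n \<in> borel_measurable (S n)) \<and> (\<forall>n. integrable M (f n)) \<and>
     (\<forall>i j. i \<le> j \<longrightarrow> (AE x in M. real_cond_exp M (S i) (f j) x = f i x))"

definition martingale_L1_norm :: "'a measure \<Rightarrow> (nat \<Rightarrow> 'a \<Rightarrow> real) \<Rightarrow> ennreal" where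
  "martingale_L1_norm M f = (SUP n. \<integral>\<^sup>+ x. ennreal \<bar>f n x\<bar> \<partial>M)"

definition L1_martingale :: "'a measure \<Rightarrow> (nat \<Rightarrow> 'a measure) \<Rightarrow> (nat \<Rightarrow> 'a \<Rightarrow> real) \<Rightarrow> bool" where
  "L1_martingale M S f \<longleftrightarrow> martingale M S f \<and> martingale_L1_norm M f < \<infinity>"

definition martingale_transform ::
    "(nat \<Rightarrow> real) \<Rightarrow> (nat \<Rightarrow> 'a \<Rightarrow> real) \<Rightarrow> nat \<Rightarrow> 'a \<Rightarrow> real" where
  "martingale_transform \<alpha> f n x = (\<Sum>j=1..n. \<alpha> (j - 1) * (f j x - f (j - 1) x))"

definition periodic_seq :: "(nat \<Rightarrow> real) \<Rightarrow> bool" where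
  "periodic_seq \<alpha> \<longleftrightarrow> (\<exists>m\<ge>1. \<forall>n. \<alpha> (n + m) = \<alpha> n)"

end

theory Submission
  imports Defs
begin

text \<open>
  If \<open>\<alpha> 1\<close> is a combination of the others, the triangle inequality suffices. Conversely, put
  \<open>\<Phi> y = C * (\<bar>y 2\<bar> + \<dots> + \<bar>y l\<bar>) - \<bar>y 1\<bar>\<close> and let \<open>W y\<close> be the Bellman function: the least mean value of \<open>\<Phi>\<close>
  that a vector of transforms started at \<open>y\<close> can reach. The inequality bounds \<open>W\<close> from below; \<open>W\<close> is
  Lipschitz and positively homogeneous of degree one, and \<open>W \<le> \<Phi>\<close>. Increments at times congruent to
  \<open>k\<close> modulo the common period move \<open>y\<close> in the direction \<open>A\<^sub>k = (\<alpha> j k)\<^sub>j\<close>, and by uniform growth each atom can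
  be split in two with a ratio bounded away from 0 and 1, so \<open>W\<close> is convex in each direction \<open>A\<^sub>k\<close>. As
  in the theorem of Kirchheim and Kristensen on homogeneous rank-one convex functions, such a \<open>W\<close> has
  a linear minorant on the span of the \<open>A\<^sub>k\<close>. Hence \<open>\<Phi>\<close> has one, and comparing it at \<open>y\<close> and \<open>-y\<close> shows
  that \<open>y 2 = \<dots> = y l = 0\<close> forces \<open>y 1 = 0\<close> on the span, which is the linear dependence of \<open>\<alpha> 1\<close>.
\<close>

subsection \<open>Separately convex homogeneous functions\<close>

text \<open>Elimination of one functional at a time. Either \<open>\<alpha> i\<close> vanishes on
  the common kernel of the others and gets coefficient 0, or some \<open>u\<close> in that kernel
  detects it, and a multiple of \<open>\<alpha> i\<close> is subtracted from
  \<open>\<beta>\<close>.\<close>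

lemma linear_combination_of_kernel_subset:
  fixes \<alpha> :: "'j \<Rightarrow> nat \<Rightarrow> real" and \<beta> :: "nat \<Rightarrow> real"
  assumes "finite J"
    and "\<And>x. (\<forall>j\<in>J. (\<Sum>k<m. x k * \<alpha> j k) = 0) \<Longrightarrow> (\<Sum>k<m. x k * \<beta> k) = 0"
  shows "\<exists>c. \<forall>k<m. \<beta> k = (\<Sum>j\<in>J. c j * \<alpha> j k)"
  using assms
proof (induction J arbitrary: \<beta> rule: finite_induct)
  case empty
  have "\<beta> k = 0" if "k < m" for k
    using empty[of "\<lambda>i. if i = k then 1 else 0"] that by (simp add: if_distrib[of "\<lambda>x. x * _"] cong: if_cong)
  then show ?case by simp
next
  case (insert i J)
  show ?case
  proof (cases "\<exists>x. (\<forall>j\<in>J. (\<Sum>k<m. x k * \<alpha> j k) = 0) \<and> (\<Sum>k<m. x k * \<alpha> i k) \<noteq> 0")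
    case False
    then obtain c where c: "\<forall>k<m. \<beta> k = (\<Sum>j\<in>J. c j * \<alpha> j k)"
      using insert.IH[of \<beta>] insert.prems by (metis insert_iff)
    have "(\<Sum>j\<in>J. (c(i := 0)) j * \<alpha> j k) = (\<Sum>j\<in>J. c j * \<alpha> j k)" for k
      using insert.hyps by (intro sum.cong) auto
    then have "\<forall>k<m. \<beta> k = (\<Sum>j\<in>insert i J. (c(i := 0)) j * \<alpha> j k)"
      using c insert.hyps by simp
    then show ?thesis by blast
  next
    case True
    then obtain u where u: "\<forall>j\<in>J. (\<Sum>k<m. u k * \<alpha> j k) = 0" "(\<Sum>k<m. u k * \<alpha> i k) \<noteq> 0"
      by blast
    \<comment> \<open>Chosen so that \<open>\<beta> - r * \<alpha> i\<close> vanishes on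
      \<open>u\<close>.\<close>
    define r where "r = (\<Sum>k<m. u k * \<beta> k) / (\<Sum>k<m. u k * \<alpha> i k)"
    have "\<exists>c. \<forall>k<m. \<beta> k - r * \<alpha> i k = (\<Sum>j\<in>J. c j * \<alpha> j k)"
    proof (rule insert.IH)
      fix x assume x: "\<forall>j\<in>J. (\<Sum>k<m. x k * \<alpha> j k) = 0"
      \<comment> \<open>Chosen so that \<open>x - q * u\<close> is also killed by
        \<open>\<alpha> i\<close>; the hypothesis on the larger index set then applies to
        it.\<close>
      define q where "q = (\<Sum>k<m. x k * \<alpha> i k) / (\<Sum>k<m. u k * \<alpha> i k)"
      have lin: "(\<Sum>k<m. (x k - q * u k) * a k) = (\<Sum>k<m. x k * a k) - q * (\<Sum>k<m. u k * a k)" for a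
        by (simp add: left_diff_distrib sum_subtractf sum_distrib_left mult.assoc)
      have "(\<Sum>k<m. (x k - q * u k) * \<beta> k) = 0"
        by (rule insert.prems) (use x u in \<open>simp add: lin, simp add: q_def\<close>)
      then have "(\<Sum>k<m. x k * \<beta> k) = q * (\<Sum>k<m. u k * \<beta> k)"
        by (simp add: lin)
      moreover have "(\<Sum>k<m. x k * (\<beta> k - r * \<alpha> i k))
          = (\<Sum>k<m. x k * \<beta> k) - r * (\<Sum>k<m. x k * \<alpha> i k)"
        by (simp add: right_diff_distrib sum_subtractf sum_distrib_left mult.left_commute)
      ultimately show "(\<Sum>k<m. x k * (\<beta> k - r * \<alpha> i k)) = 0"
        by (simp add: q_def r_def)
    qed
    then obtain c where c: "\<forall>k<m. \<beta> k - r * \<alpha> i k = (\<Sum>j\<in>J. c j * \<alpha> j k)" by blast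
    have "(\<Sum>j\<in>J. (c(i := r)) j * \<alpha> j k) = (\<Sum>j\<in>J. c j * \<alpha> j k)" for k
      using insert.hyps by (intro sum.cong) auto
    then have "(\<Sum>j\<in>insert i J. (c(i := r)) j * \<alpha> j k) = r * \<alpha> i k + (\<Sum>j\<in>J. c j * \<alpha> j k)" for k
      using insert.hyps by simp
    then have "\<forall>k<m. \<beta> k = (\<Sum>j\<in>insert i J. (c(i := r)) j * \<alpha> j k)"
      using c by (metis add.commute diff_add_cancel)
    then show ?thesis by blast
  qed
qed

text \<open>The splitting ratio \<open>p\<close> is not under control. If \<open>g\<close> exceeded a chord, then the difference plus
  a small strictly convex parabola vanishing at both ends would have an interior maximum, where the
  hypothesis fails for every \<open>p\<close>.\<close>
lemma convex_on_if_weakly_convex: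
  fixes g :: "real \<Rightarrow> real"
  assumes cont: "continuous_on UNIV g" and "0 < \<delta>"
    and weak: "\<And>t s w. 0 < s \<Longrightarrow>
      (\<And>p. \<delta> \<le> p \<Longrightarrow> p \<le> 1 - \<delta> \<Longrightarrow> p * g (t + (1 - p) * s) + (1 - p) * g (t - p * s) < w) \<Longrightarrow> g t \<le> w"
  shows "convex_on UNIV g"
proof (rule convex_on_linorderI)
  fix u x y :: real
  assume u: "0 < u" "u < 1" and "x < y"
  define z where "z = (1 - u) *\<^sub>R x + u *\<^sub>R y"
  have z: "z - x = u * (y - x)" "z - y = (u - 1) * (y - x)"
    by (auto simp: z_def algebra_simps)
  show "g ((1 - u) *\<^sub>R x + u *\<^sub>R y) \<le> (1 - u) * g x + u * g y"
  proof (rule ccontr)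
    assume neg: "\<not> ?thesis"
    define a where "a = (g y - g x) / (y - x)"
    define \<phi> where "\<phi> t = g t - g x - a * (t - x)" for t
    have "a * (z - x) = u * (g y - g x)" using \<open>x < y\<close> by (simp add: a_def z)
    moreover have "(1 - u) * g x + u * g y < g z" using neg by (simp add: z_def)
    ultimately have "0 < \<phi> z" by (simp add: \<phi>_def left_diff_distrib right_diff_distrib)
    have \<phi>0: "\<phi> x = 0" "\<phi> y = 0" using \<open>x < y\<close> by (auto simp: \<phi>_def a_def)
    \<comment> \<open>With this size the parabola takes away at most half of
      \<open>\<phi> z\<close>, so \<open>\<psi>\<close> is still positive at \<open>z\<close> while
      it vanishes at \<open>x\<close> and \<open>y\<close>.\<close>
    define \<epsilon> where "\<epsilon> = \<phi> z / (2 * (y - x) ^ 2)"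
    have "0 < \<epsilon>" using \<open>0 < \<phi> z\<close> \<open>x < y\<close> by (simp add: \<epsilon>_def)
    define \<psi> where "\<psi> t = \<phi> t + \<epsilon> * ((t - x) * (t - y))" for t
    have "\<epsilon> * ((z - x) * (z - y)) = - (u * (1 - u)) * (\<phi> z / 2)"
    proof -
      have "\<epsilon> * ((z - x) * (z - y)) = (u * (u - 1)) * (\<epsilon> * (y - x)\<^sup>2)"
        by (simp add: z power2_eq_square mult_ac)
      also have "\<epsilon> * (y - x)\<^sup>2 = \<phi> z / 2" using \<open>x < y\<close> by (simp add: \<epsilon>_def)
      finally show ?thesis by (simp add: algebra_simps)
    qed
    moreover have "u * (1 - u) * (\<phi> z / 2) \<le> 1 * (\<phi> z / 2)"
      by (rule mult_right_mono) (use u \<open>0 < \<phi> z\<close> in \<open>auto intro: mult_le_one\<close>)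
    ultimately have "0 < \<psi> z" using \<open>0 < \<phi> z\<close> by (simp add: \<psi>_def)
    have "continuous_on {x..y} \<psi>" unfolding \<psi>_def \<phi>_def
      by (intro continuous_intros continuous_on_subset[OF cont]) auto
    then obtain t where t: "t \<in> {x..y}" and max: "\<And>t'. t' \<in> {x..y} \<Longrightarrow> \<psi> t' \<le> \<psi> t"
      using continuous_attains_sup[of "{x..y}" \<psi>] \<open>x < y\<close> by fastforce
    have "z \<in> {x..y}" using z u \<open>x < y\<close> 
      by (smt (verit) atLeastAtMost_iff mult_nonneg_nonneg mult_nonpos_nonneg)
    then have "0 < \<psi> t" using max[of z] \<open>0 < \<psi> z\<close> by simp
    then have "x < t" "t < y"
      using t \<phi>0 by (auto simp: \<psi>_def order_less_le)
    \<comment> \<open>For every \<open>p\<close> in the unit interval both split points around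
      \<open>t\<close> stay inside \<open>{x..y}\<close>.\<close>
    define s where "s = min (t - x) (y - t)"
    have "0 < s" using \<open>x < t\<close> \<open>t < y\<close> by (simp add: s_def)
    \<comment> \<open>The \<open>p\<close>-mean of \<open>\<psi>\<close> cannot exceed its maximum,
      while the mean of the parabola exceeds its value by
      \<open>\<epsilon> * p * (1 - p) * s^2\<close>, which is at least
      \<open>\<epsilon> * \<delta>^2 * s^2\<close>. Giving away half of this makes the premise of
      \<open>weak\<close> strict.\<close>
    have "g t \<le> g t - \<epsilon> * \<delta>\<^sup>2 * s\<^sup>2 / 2"
    proof (rule weak[OF \<open>0 < s\<close>])
      fix p assume p: "\<delta> \<le> p" "p \<le> 1 - \<delta>"
      have "(1 - p) * s \<le> 1 * s" "0 \<le> (1 - p) * s" "p * s \<le> 1 * s" "0 \<le> p * s"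
        using p \<open>0 < \<delta>\<close> \<open>0 < s\<close> by (auto intro!: mult_right_mono simp del: mult_1)
      then have in_range: "t + (1 - p) * s \<in> {x..y}" "t - p * s \<in> {x..y}"
        using \<open>x < t\<close> \<open>t < y\<close> by (auto simp: s_def)
      have "p * \<psi> (t + (1 - p) * s) + (1 - p) * \<psi> (t - p * s) \<le> p * \<psi> t + (1 - p) * \<psi> t"
        using p \<open>0 < \<delta>\<close> max in_range by (intro add_mono mult_left_mono) auto
      then have "p * g (t + (1 - p) * s) + (1 - p) * g (t - p * s) \<le> g t - \<epsilon> * (p * (1 - p)) * s\<^sup>2"
        unfolding \<psi>_def \<phi>_def by (simp add: algebra_simps power2_eq_square)
      moreover have "\<delta> * \<delta> \<le> p * (1 - p)"
        using p \<open>0 < \<delta>\<close> by (intro mult_mono) auto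
      then have "\<epsilon> * (\<delta> * \<delta>) * s\<^sup>2 \<le> \<epsilon> * (p * (1 - p)) * s\<^sup>2"
        using \<open>0 < \<epsilon>\<close> by (intro mult_right_mono mult_left_mono) auto
      moreover have "0 < \<epsilon> * (\<delta> * \<delta>) * s\<^sup>2"
        using \<open>0 < \<epsilon>\<close> \<open>0 < \<delta>\<close> \<open>0 < s\<close> by simp
      ultimately show "p * g (t + (1 - p) * s) + (1 - p) * g (t - p * s) < g t - \<epsilon> * \<delta>\<^sup>2 * s\<^sup>2 / 2"
        by (simp add: power2_eq_square)
    qed
    moreover have "0 < \<epsilon> * \<delta>\<^sup>2 * s\<^sup>2"
      using \<open>0 < \<epsilon>\<close> \<open>0 < \<delta>\<close> \<open>0 < s\<close> by simp
    ultimately show False by simp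
  qed
qed simp

text \<open>A secant of positive slope would force \<open>h\<close> to grow at least linearly to the
  right of \<open>t\<close>.\<close>

lemma convex_bdd_above_imp_antimono:
  fixes h :: "real \<Rightarrow> real"
  assumes conv: "convex_on UNIV h" and bdd: "\<And>t. 0 \<le> t \<Longrightarrow> h t \<le> B" and "s \<le> t"
  shows "h t \<le> h s"
proof (rule ccontr)
  assume "\<not> h t \<le> h s"
  then have "s < t" "h s < h t" using \<open>s \<le> t\<close> by (auto simp: order_less_le)
  define a where "a = (h t - h s) / (t - s)"
  have "0 < a" using \<open>s < t\<close> \<open>h s < h t\<close> by (simp add: a_def)
  \<comment> \<open>So far to the right that the secant line already exceeds \<open>B\<close>;
    nonnegative, because the bound on \<open>h\<close> is assumed only there.\<close>
  define r where "r = Max {t + 1, 0, t + (\<bar>B\<bar> + \<bar>h t\<bar> + 1) / a}"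
  have r: "t < r" "0 \<le> r" "t + (\<bar>B\<bar> + \<bar>h t\<bar> + 1) / a \<le> r" by (auto simp: r_def)
  have "h t \<le> (h r - h s) / (r - s) * (t - s) + h s"
    by (rule convex_onD_Icc'[OF convex_on_subset[OF conv]]) (use r \<open>s < t\<close> in auto)
  then have "a \<le> (h r - h s) / (r - s)"
    using \<open>s < t\<close> by (simp add: a_def pos_divide_le_eq)
  then have "a * (r - s) \<le> h r - h s" using r \<open>s < t\<close> by (simp add: pos_le_divide_eq)
  moreover have "a * (t - s) = h t - h s" using \<open>s < t\<close> by (simp add: a_def)
  moreover have "a * (r - s) = a * (r - t) + a * (t - s)" by (simp add: algebra_simps)
  moreover have "\<bar>B\<bar> + \<bar>h t\<bar> + 1 \<le> a * (r - t)"
    using r(3) \<open>0 < a\<close> by (simp add: field_simps)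
  ultimately have "B < h r" by linarith
  then show False using bdd[of r] r by simp
qed

text \<open>The Lipschitz clause sums over \<open>i < m\<close> only, so \<open>W\<close> ignores
  all later coordinates: a function on sequences stands for one on m-dimensional space.\<close>

definition hom_sep_convex :: "nat \<Rightarrow> real \<Rightarrow> ((nat \<Rightarrow> real) \<Rightarrow> real) \<Rightarrow> bool" where
  "hom_sep_convex m K W \<longleftrightarrow>
     (\<forall>x r. 0 < r \<longrightarrow> W (\<lambda>i. r * x i) = r * W x) \<and>
     (\<forall>x y. \<bar>W x - W y\<bar> \<le> K * (\<Sum>i<m. \<bar>x i - y i\<bar>)) \<and>
     (\<forall>k<m. \<forall>x. convex_on UNIV (\<lambda>t. W (x(k := t))))"

text \<open>The minorant is \<open>G x = lim\<^sub>t\<^sub>\<rightarrow>\<^sub>\<infinity> (W (x + t e\<^sub>k) - t W e\<^sub>k)\<close>, where \<open>e\<^sub>k\<close> is the \<open>k\<close>th unit vector; the last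
  clause says that linearity in the directions treated earlier survives.\<close>
lemma hom_sep_convex_linearize:
  assumes W: "hom_sep_convex m K W" and "k < m"
  obtains G c where "hom_sep_convex m K G" "\<And>x. G x \<le> W x"
    "\<And>x s. G (x(k := x k + s)) = G x + s * c"
    "\<And>v b. \<forall>x s. W (\<lambda>i. x i + s * v i) = W x + s * b \<Longrightarrow> \<forall>x s. G (\<lambda>i. x i + s * v i) = G x + s * b"
proof -
  define e :: "nat \<Rightarrow> real" where "e = (\<lambda>_. 0)(k := 1)"
  define c where "c = W e"
  define h where "h x t = W (x(k := x k + t)) - t * c" for x t
  have hom: "W (\<lambda>i. r * x i) = r * W x" if "0 < r" for r x
    using W that by (simp add: hom_sep_convex_def)
  have lip: "\<bar>W x - W y\<bar> \<le> K * (\<Sum>i<m. \<bar>x i - y i\<bar>)" for x y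
    using W by (simp add: hom_sep_convex_def)
  have conv: "convex_on UNIV (\<lambda>t. W (x(i := t)))" if "i < m" for i x
    using W that by (simp add: hom_sep_convex_def)
  \<comment> \<open>By homogeneity \<open>t * c\<close> is the value of \<open>W\<close> at
    \<open>t * e\<close>. The two arguments differ by \<open>x\<close> for every \<open>t\<close>,
    so the Lipschitz bound is uniform in \<open>t\<close>.\<close>
  have h_bd: "\<bar>h x t\<bar> \<le> K * (\<Sum>i<m. \<bar>x i\<bar>)" if "0 < t" for x t
  proof -
    have "(\<lambda>i. t * e i) = (\<lambda>_. 0)(k := t)" by (auto simp: e_def)
    with hom[OF that, of e] have "h x t = W (x(k := x k + t)) - W ((\<lambda>_. 0)(k := t))"
      by (simp add: h_def c_def)
    also have "\<bar>\<dots>\<bar> \<le> K * (\<Sum>i<m. \<bar>(x(k := x k + t)) i - ((\<lambda>_. 0)(k := t)) i\<bar>)" by (rule lip)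
    also have "(\<Sum>i<m. \<bar>(x(k := x k + t)) i - ((\<lambda>_. 0)(k := t)) i\<bar>) = (\<Sum>i<m. \<bar>x i\<bar>)"
      by (intro sum.cong) auto
    finally show ?thesis .
  qed
  have h_conv: "convex_on UNIV (h x)" for x
  proof -
    have "convex_on UNIV (\<lambda>t. W (x(k := x k + t)))"
    proof (rule convex_onI)
      fix u s t :: real assume u: "0 < u" "u < 1"
      have "x k + ((1 - u) *\<^sub>R s + u *\<^sub>R t) = (1 - u) *\<^sub>R (x k + s) + u *\<^sub>R (x k + t)"
        by (simp add: algebra_simps)
      then show "W (x(k := x k + ((1 - u) *\<^sub>R s + u *\<^sub>R t)))
          \<le> (1 - u) * W (x(k := x k + s)) + u * W (x(k := x k + t))"
        using convex_onD[OF conv[OF \<open>k < m\<close>, of x], of u "x k + s" "x k + t"] u by simp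
    qed simp
    moreover have "convex_on UNIV (\<lambda>t. - (t * c))" by (rule convex_onI) (auto simp: algebra_simps)
    ultimately show ?thesis unfolding h_def diff_conv_add_uminus by (rule convex_on_add)
  qed
  have h_bd0: "h x t \<le> max (h x 0) (K * (\<Sum>i<m. \<bar>x i\<bar>))" if "0 \<le> t" for x t
    using h_bd[of t x] that by (cases "t = 0") auto
  \<comment> \<open>Convexity and the upper bound make \<open>h x\<close> nonincreasing on the whole
    line, so its infimum is its limit at infinity.\<close>
  have h_anti: "h x t \<le> h x s" if "s \<le> t" for x s t
    using convex_bdd_above_imp_antimono[OF h_conv h_bd0 that] .
  \<comment> \<open>Homogeneity bounds \<open>h\<close> only at positive times; smaller times are
    compared with time 1 by monotonicity.\<close>
  have h_lower: "- (K * (\<Sum>i<m. \<bar>x i\<bar>)) \<le> h x t" for x t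
    using h_anti[of t "max t 1" x] h_bd[of "max t 1" x] by linarith
  define G where "G x = (INF t. h x t)" for x
  have bdd: "bdd_below (range (h x))" for x
    using h_lower by (auto intro!: bdd_belowI)
  have G_le: "G x \<le> h x t" for x t
    unfolding G_def by (rule cINF_lower[OF bdd]) simp
  have lim: "(h x \<longlongrightarrow> G x) at_top" for x
  proof (rule decreasing_tendsto)
    show "\<forall>\<^sub>F t in at_top. G x \<le> h x t" by (simp add: G_le)
    fix y assume "G x < y"
    then obtain t where "h x t < y" unfolding G_def using cINF_less_iff[OF _ bdd] by blast
    then show "\<forall>\<^sub>F t in at_top. h x t < y"
      unfolding eventually_at_top_linorder using h_anti by (intro exI[of _ t]) (meson le_less_trans)
  qed
  have "hom_sep_convex m K G"
    unfolding hom_sep_convex_def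
  proof (intro conjI allI impI)
    fix x :: "nat \<Rightarrow> real" and r :: real assume "0 < r"
    \<comment> \<open>Scaling \<open>x\<close> only reparametrizes time, which does not affect the
      limit at infinity.\<close>
    have "h (\<lambda>i. r * x i) t = r * h x (t / r)" for t
    proof -
      have "(\<lambda>i. r * x i)(k := r * x k + t) = (\<lambda>i. r * (x(k := x k + t / r)) i)"
        using \<open>0 < r\<close> by (auto simp: field_simps)
      then show ?thesis unfolding h_def using hom[OF \<open>0 < r\<close>, of "x(k := x k + t / r)"] \<open>0 < r\<close>
        by (simp add: right_diff_distrib)
    qed
    moreover have "filterlim (\<lambda>t. t / r) at_top at_top"
      using \<open>0 < r\<close> by real_asymp
    from tendsto_mult_left[OF filterlim_compose[OF lim[of x] this], of r]
    have "((\<lambda>t. r * h x (t / r)) \<longlongrightarrow> r * G x) at_top" .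
    ultimately have "(h (\<lambda>i. r * x i) \<longlongrightarrow> r * G x) at_top" by presburger
    then show "G (\<lambda>i. r * x i) = r * G x"
      using tendsto_unique[OF trivial_limit_at_top_linorder lim] by blast
  next
    fix x y
    have "\<bar>h x t - h y t\<bar> \<le> K * (\<Sum>i<m. \<bar>x i - y i\<bar>)" for t
    proof -
      have "\<bar>h x t - h y t\<bar> = \<bar>W (x(k := x k + t)) - W (y(k := y k + t))\<bar>" by (simp add: h_def)
      also note lip
      also have "(\<Sum>i<m. \<bar>(x(k := x k + t)) i - (y(k := y k + t)) i\<bar>) = (\<Sum>i<m. \<bar>x i - y i\<bar>)"
        by (intro sum.cong) auto
      finally show ?thesis .
    qed
    then show "\<bar>G x - G y\<bar> \<le> K * (\<Sum>i<m. \<bar>x i - y i\<bar>)"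
      by (intro tendsto_upperbound[OF tendsto_rabs[OF tendsto_diff[OF lim lim]]]) auto
  next
    fix i x assume "i < m"
    show "convex_on UNIV (\<lambda>t. G (x(i := t)))"
    proof (rule convex_onI)
      fix u s t :: real assume u: "0 < u" "u < 1"
      have "h (x(i := (1 - u) *\<^sub>R s + u *\<^sub>R t)) \<tau> \<le> (1 - u) * h (x(i := s)) \<tau> + u * h (x(i := t)) \<tau>" for \<tau>
      proof (cases "i = k")
        case True
        have "(1 - u) *\<^sub>R s + u *\<^sub>R t + \<tau> = (1 - u) *\<^sub>R (s + \<tau>) + u *\<^sub>R (t + \<tau>)"
          by (simp add: algebra_simps)
        with True show ?thesis
          using convex_onD[OF conv[OF \<open>k < m\<close>, of x], of u "s + \<tau>" "t + \<tau>"] u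
          by (simp add: h_def algebra_simps)
      next
        case False
        then show ?thesis
          using convex_onD[OF conv[OF \<open>i < m\<close>, of "x(k := x k + \<tau>)"], of u s t] u
          by (simp add: h_def fun_upd_twist algebra_simps)
      qed
      then show "G (x(i := (1 - u) *\<^sub>R s + u *\<^sub>R t)) \<le> (1 - u) * G (x(i := s)) + u * G (x(i := t))"
        by (intro tendsto_le[OF trivial_limit_at_top_linorder
              tendsto_add[OF tendsto_mult_left[OF lim] tendsto_mult_left[OF lim]] lim]) auto
    qed simp
  qed
  moreover have "G x \<le> W x" for x using G_le[of x 0] by (simp add: h_def)
  moreover have "G (x(k := x k + s)) = G x + s * c" for x s
  proof -
    \<comment> \<open>Moving \<open>x\<close> by \<open>s\<close> along \<open>e\<close> is a time
      shift, and the linear correction term accounts for exactly \<open>s * c\<close>.\<close>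
    have "filterlim (\<lambda>t. s + t) at_top at_top" by real_asymp
    from tendsto_add[OF filterlim_compose[OF lim[of x] this] tendsto_const[of "s * c"]]
    have "((\<lambda>t. h x (s + t) + s * c) \<longlongrightarrow> G x + s * c) at_top" .
    moreover have "h (x(k := x k + s)) t = h x (s + t) + s * c" for t
      by (simp add: h_def algebra_simps)
    ultimately have "(h (x(k := x k + s)) \<longlongrightarrow> G x + s * c) at_top" by presburger
    then show ?thesis using tendsto_unique[OF trivial_limit_at_top_linorder lim] by blast
  qed
  moreover have "G (\<lambda>i. x i + s * v i) = G x + s * b"
    if "\<And>x s. W (\<lambda>i. x i + s * v i) = W x + s * b" for v b x s
  proof -
    have "h (\<lambda>i. x i + s * v i) t = h x t + s * b" for t
    proof -
      have "(\<lambda>i. x i + s * v i)(k := x k + s * v k + t) = (\<lambda>i. (x(k := x k + t)) i + s * v i)"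
        by auto
      then show ?thesis using that[of "x(k := x k + t)" s] by (simp add: h_def)
    qed
    then have "(h (\<lambda>i. x i + s * v i) \<longlongrightarrow> G x + s * b) at_top"
      using tendsto_add[OF lim[of x] tendsto_const[of "s * b"]] by presburger
    then show ?thesis using tendsto_unique[OF trivial_limit_at_top_linorder lim] by blast
  qed
  ultimately show ?thesis using that by blast
qed

text \<open>The coordinates are linearized one after another: each step goes below the previous
  function and keeps the linearity already gained. After \<open>m\<close> steps the minorant is
  linear.\<close>

lemma hom_sep_convex_linear_minorant:
  assumes "hom_sep_convex m K W"
  obtains c where "\<And>x. (\<Sum>k<m. c k * x k) \<le> W x"
proof -
  have "\<exists>G c. hom_sep_convex m K G \<and> (\<forall>x. G x \<le> W x) \<and>
          (\<forall>k<j. \<forall>x s. G (x(k := x k + s)) = G x + s * c k)" if "j \<le> m" for j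
    using that
  proof (induction j)
    case 0
    then show ?case using assms by auto
  next
    case (Suc j)
    then obtain G c where G: "hom_sep_convex m K G" "\<And>x. G x \<le> W x"
        "\<And>k x s. k < j \<Longrightarrow> G (x(k := x k + s)) = G x + s * c k" using Suc_leD by blast
    obtain G' b where G': "hom_sep_convex m K G'" "\<And>x. G' x \<le> G x"
      "\<And>x s. G' (x(j := x j + s)) = G' x + s * b"
      "\<And>v a. \<forall>x s. G (\<lambda>i. x i + s * v i) = G x + s * a \<Longrightarrow> \<forall>x s. G' (\<lambda>i. x i + s * v i) = G' x + s * a"
      using hom_sep_convex_linearize[OF G(1), of j] Suc.prems by auto
    \<comment> \<open>A coordinate shift in the form of a shift along a vector, for which
      preservation of linearity is stated.\<close>
    have upd: "x(k := x k + s) = (\<lambda>i. x i + s * ((\<lambda>_. 0)(k := 1)) i)" for x :: "nat \<Rightarrow> real" and k s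
      by auto
    have "G' (x(k := x k + s)) = G' x + s * c k" if "k < j" for k x s
      unfolding upd by (rule G'(4)[rule_format]) (use G(3)[OF that] in \<open>simp add: upd\<close>)
    then have "G' (x(k := x k + s)) = G' x + s * (c(j := b)) k" if "k < Suc j" for k x s
      using that G'(3) by (auto simp: less_Suc_eq)
    then show ?case using G'(1,2) G(2) order_trans by metis
  qed
  from this[OF order_refl] obtain G c where "hom_sep_convex m K G" "\<forall>x. G x \<le> W x"
    "\<forall>k<m. \<forall>x s. G (x(k := x k + s)) = G x + s * c k" by (elim exE conjE) (rule that)
  note G = this(1) this(2)[rule_format] this(3)[rule_format]
  have hom: "\<forall>x r. 0 < r \<longrightarrow> G (\<lambda>i. r * x i) = r * G x"
    using G(1) unfolding hom_sep_convex_def by (rule conjunct1)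
  \<comment> \<open>Homogeneity holds for positive factors; the factor 2 already forces the value 0
    at the origin.\<close>
  have "G (\<lambda>i. 2 * 0) = 2 * G (\<lambda>_. 0)"
    using hom[rule_format, of 2 "\<lambda>_. 0"] by simp
  then have G0: "G (\<lambda>_. 0) = 0" by simp
  have partial: "G (\<lambda>i. if i < j then x i else 0) = (\<Sum>k<j. c k * x k)" if "j \<le> m" for x j
    using that
  proof (induction j)
    case 0
    then show ?case by (simp add: G0)
  next
    case (Suc j)
    have "(\<lambda>i. if i < Suc j then x i else 0) = (\<lambda>i. if i < j then x i else 0)(j := 0 + x j)"
      by (auto simp: less_Suc_eq)
    then show ?case
      using G(3)[of j "\<lambda>i. if i < j then x i else 0" "x j"] Suc by simp
  qed
  have "(\<Sum>k<m. c k * x k) \<le> W x" for x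
  proof -
    \<comment> \<open>The right-hand side is zero, so coordinates from \<open>m\<close> on can be
      cut off.\<close>
    have "\<bar>G x - G (\<lambda>i. if i < m then x i else 0)\<bar> \<le> K * (\<Sum>i<m. \<bar>x i - (if i < m then x i else 0)\<bar>)"
      using G(1) unfolding hom_sep_convex_def by blast
    then have "G x = G (\<lambda>i. if i < m then x i else 0)" by simp
    then show ?thesis using partial[of m x] G(2)[of x] by simp
  qed
  then show ?thesis using that by blast
qed

subsection \<open>Martingale differences over a finite filtration\<close>

locale finite_filtered_space = prob_space M for M :: "'a measure" +
  fixes S :: "nat \<Rightarrow> 'a measure"
  assumes finite_filtration: "finite_filtration M S"
begin

lemma subalgebra_S: "subalgebra M (S n)" and finite_sets_S: "finite (sets (S n))"
  using finite_filtration by (auto simp: finite_filtration_def)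

lemma space_S: "space (S n) = space M" and sets_S: "A \<in> sets (S n) \<Longrightarrow> A \<in> sets M"
  using subalgebra_S[of n] by (auto simp: subalgebra_def)

lemma sets_S_mono: "i \<le> j \<Longrightarrow> A \<in> sets (S i) \<Longrightarrow> A \<in> sets (S j)"
  using finite_filtration unfolding finite_filtration_def filtration_def by blast

lemma measurable_S_mono: "i \<le> j \<Longrightarrow> f \<in> borel_measurable (S i) \<Longrightarrow> f \<in> borel_measurable (S j)"
  by (rule measurable_from_subalg[of _ "S i"]) (auto simp: subalgebra_def space_S intro: sets_S_mono)

text \<open>Distinct values have distinct preimages in a finite algebra, so \<open>f\<close> takes
  finitely many values and is bounded.\<close>

lemma integrable_S:
  fixes f :: "'a \<Rightarrow> real"
  assumes f: "f \<in> borel_measurable (S n)"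
  shows "integrable M f"
proof -
  have "finite ((\<lambda>r. f -` {r} \<inter> space (S n)) ` (f ` space (S n)))"
    by (rule finite_subset[OF _ finite_sets_S[of n]]) (use f in \<open>auto intro: measurable_sets\<close>)
  moreover have "inj_on (\<lambda>r. f -` {r} \<inter> space (S n)) (f ` space (S n))"
    by (rule inj_onI) auto
  ultimately have "finite (f ` space M)"
    by (simp add: finite_image_iff space_S)
  then have "\<bar>f x\<bar> \<le> Max ((\<lambda>r. \<bar>r\<bar>) ` f ` space M)" if "x \<in> space M" for x
    using that by (intro Max_ge) auto
  then show ?thesis
    using measurable_from_subalg[OF subalgebra_S f]
    by (intro integrable_const_bound[where B = "Max ((\<lambda>r. \<bar>r\<bar>) ` f ` space M)"] AE_I2) (simp_all only: real_norm_def)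
qed

lemma atom_subset_exists:
  assumes "A \<in> sets (S n)" "A \<noteq> {}"
  obtains b where "b \<in> atoms_of (S n)" "b \<subseteq> A"
proof -
  let ?X = "{b \<in> sets (S n). b \<noteq> {} \<and> b \<subseteq> A}"
  have "\<exists>b\<in>?X. \<forall>c\<in>?X. c \<le> b \<longrightarrow> b = c"
    by (rule finite_has_minimal) (use assms finite_sets_S[of n] in auto)
  then obtain b where b: "b \<in> ?X" and min: "\<forall>c\<in>?X. c \<subseteq> b \<longrightarrow> b = c"
    by (elim bexE) (rule that)
  have "c = {} \<or> c = b" if "c \<in> sets (S n)" "c \<subseteq> b" for c
    using bspec[OF min, of c] that b by blast
  then show ?thesis using b by (intro that[of b]) (auto simp: atoms_of_def)
qed

text \<open>Builds a set of the algebra atom by atom. The induction runs on the number of measurable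
  subsets, since the set itself may be infinite.\<close>

lemma sets_S_induct [consumes 1, case_names empty Un]:
  assumes "A \<in> sets (S n)"
    and empty: "P {}"
    and Un: "\<And>a B. a \<in> atoms_of (S n) \<Longrightarrow> a \<subseteq> A \<Longrightarrow> B \<in> sets (S n) \<Longrightarrow> B \<subseteq> A \<Longrightarrow> a \<inter> B = {} \<Longrightarrow> P B \<Longrightarrow> P (a \<union> B)"
  shows "P A"
proof -
  have "P B" if "B \<in> sets (S n)" "B \<subseteq> A" for B
    using that
  proof (induction "card {C \<in> sets (S n). C \<subseteq> B}" arbitrary: B rule: less_induct)
    case less
    show ?case
    proof (cases "B = {}")
      case False
      then obtain a where a: "a \<in> atoms_of (S n)" "a \<subseteq> B"
        using atom_subset_exists less.prems(1) by blast
      then have "a \<in> sets (S n)" "a \<noteq> {}" by (auto simp: atoms_of_def)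
      then have "B - a \<in> sets (S n)" "{C \<in> sets (S n). C \<subseteq> B - a} \<subset> {C \<in> sets (S n). C \<subseteq> B}"
        using less.prems a by blast+
      then have "P (B - a)"
        using less.prems finite_sets_S[of n] by (intro less.hyps psubset_card_mono) auto
      then have "P (a \<union> (B - a))"
        using a less.prems \<open>B - a \<in> sets (S n)\<close> by (intro Un) auto
      moreover have "a \<union> (B - a) = B" using a by auto
      ultimately show ?thesis by simp
    qed (simp add: empty)
  qed
  then show ?thesis using assms(1) by blast
qed

text \<open>Minimality of the chosen part \<open>b\<close> keeps it away from full measure: removing one atom
  makes it too small.\<close>
lemma balanced_split:
  assumes "grows_uniformly M S"
  obtains \<delta> where "0 < \<delta>"
    "\<And>n a. a \<in> atoms_of (S n) \<Longrightarrow> \<exists>b\<in>sets (S (Suc n)). b \<subseteq> a \<and>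
       \<delta> * measure M a \<le> measure M b \<and> measure M b \<le> (1 - \<delta>) * measure M a"
proof -
  obtain \<gamma> where "\<gamma> < 1" and \<gamma>: "\<And>n a b. a \<in> atoms_of (S n) \<Longrightarrow> b \<in> atoms_of (S (Suc n)) \<Longrightarrow>
      b \<subseteq> a \<Longrightarrow> measure M b \<le> \<gamma> * measure M a"
    using assms by (auto simp: grows_uniformly_def)
  \<comment> \<open>The bound 1/3 gives \<open>2 * \<delta> \<le> 1 - \<delta>\<close>, for the case
    where two pieces of \<open>b\<close> are both too small.\<close>
  define \<delta> where "\<delta> = min (1 - \<gamma>) (1 / 3)"
  have "\<delta> \<le> 1 - \<gamma>" "\<delta> \<le> 1 / 3" unfolding \<delta>_def by (rule min.cobounded1, rule min.cobounded2)
  then have \<delta>: "0 < \<delta>" "\<gamma> \<le> 1 - \<delta>" "2 * \<delta> \<le> 1 - \<delta>" "\<delta> \<le> 1"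
    using \<open>\<gamma> < 1\<close> by (linarith | simp add: \<delta>_def)+
  have "\<exists>b\<in>sets (S (Suc n)). b \<subseteq> a \<and>
       \<delta> * measure M a \<le> measure M b \<and> measure M b \<le> (1 - \<delta>) * measure M a"
    if a: "a \<in> atoms_of (S n)" for n a
  proof -
    let ?X = "{b \<in> sets (S (Suc n)). b \<subseteq> a \<and> \<delta> * measure M a \<le> measure M b}"
    have aS: "a \<in> sets (S n)" using a by (simp add: atoms_of_def)
    have "a \<in> ?X"
      using sets_S_mono[OF _ aS, of "Suc n"] \<delta> by (simp add: mult_left_le_one_le)
    then have "\<exists>b\<in>?X. \<forall>c\<in>?X. c \<le> b \<longrightarrow> b = c"
      by (intro finite_has_minimal) (use finite_sets_S[of "Suc n"] in auto)
    then obtain b where "b \<in> ?X" and min: "\<forall>c\<in>?X. c \<subseteq> b \<longrightarrow> b = c"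
      by (elim bexE) (rule that)
    then have b: "b \<in> sets (S (Suc n))" "b \<subseteq> a" "\<delta> * measure M a \<le> measure M b" by auto
    show ?thesis
    proof (cases "measure M b = 0")
      case True
      then show ?thesis using b \<delta> by (intro bexI[of _ b]) auto
    next
      case False
      then have "b \<noteq> {}" by auto
      then obtain c where c: "c \<in> atoms_of (S (Suc n))" "c \<subseteq> b"
        using atom_subset_exists b(1) by blast
      then have cS: "c \<in> sets (S (Suc n))" "c \<noteq> {}" by (auto simp: atoms_of_def)
      have le: "measure M c \<le> \<gamma> * measure M a" using \<gamma>[OF a c(1)] b c by blast
      have "measure M b \<le> (1 - \<delta>) * measure M a"
      proof (cases "\<delta> * measure M a \<le> measure M c")
        case True
        then have "b = c" using bspec[OF min, of c] cS b c by auto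
        then show ?thesis
          using le mult_right_mono[OF \<delta>(2) measure_nonneg[of M a]] by simp
      next
        case False
        \<comment> \<open>By minimality \<open>b - c\<close> is too small, and so is
          \<open>c\<close> in this case; hence \<open>b\<close> has less than
          \<open>2 * \<delta>\<close> of the measure of \<open>a\<close>.\<close>
        have "\<not> \<delta> * measure M a \<le> measure M (b - c)"
          using bspec[OF min, of "b - c"] b c cS by blast
        moreover have "measure M (b - c) = measure M b - measure M c"
          using b c cS sets_S by (intro finite_measure_Diff) auto
        ultimately show ?thesis
          using False mult_right_mono[OF \<delta>(3) measure_nonneg[of M a]] by simp
      qed
      then show ?thesis using b by blast
    qed
  qed
  then show ?thesis using that \<delta>(1) by blast
qed

text \<open>Martingale differences living on \<open>a\<close> in the time window from \<open>n\<close> to \<open>N\<close>; \<open>d i\<close> is the increment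
  from time \<open>i\<close> to time \<open>i + 1\<close>.\<close>
definition diff_seq :: "nat \<Rightarrow> nat \<Rightarrow> 'a set \<Rightarrow> (nat \<Rightarrow> 'a \<Rightarrow> real) \<Rightarrow> bool" where
  "diff_seq n N a d \<longleftrightarrow>
     (\<forall>i. d i \<in> borel_measurable (S (Suc i))) \<and>
     (\<forall>i x. i < n \<or> N \<le> i \<or> x \<notin> a \<longrightarrow> d i x = 0) \<and>
     (\<forall>i. \<forall>A\<in>sets (S i). (\<integral>x. indicator A x * d i x \<partial>M) = 0)"

lemma diff_seq_zero: "diff_seq n N a (\<lambda>_ _. 0)"
  by (simp add: diff_seq_def)

lemma diff_seq_weaken:
  "diff_seq n N a d \<Longrightarrow> n' \<le> n \<Longrightarrow> N \<le> N' \<Longrightarrow> a \<subseteq> a' \<Longrightarrow> diff_seq n' N' a' d"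
  unfolding diff_seq_def by (meson in_mono le_trans not_le)

lemma diff_seq_scale: "diff_seq n N a d \<Longrightarrow> diff_seq n N a (\<lambda>i x. r * d i x)"
  unfolding diff_seq_def by (simp add: mult.left_commute borel_measurable_times)

lemma integrable_indicator_event: "A \<in> sets M \<Longrightarrow> integrable M (indicator A :: 'a \<Rightarrow> real)"
  by (simp add: integrable_indicator_iff emeasure_eq_measure)

lemma integrable_indicator_mult_S:
  fixes f :: "'a \<Rightarrow> real"
  assumes "f \<in> borel_measurable (S n)" "A \<in> sets M"
  shows "integrable M (\<lambda>x. indicator A x * f x)"
  using integrable_real_mult_indicator[OF assms(2) integrable_S[OF assms(1)]] by (simp add: mult.commute)

lemma diff_seq_add:
  assumes "diff_seq n N a d" "diff_seq n N a d'"
  shows "diff_seq n N a (\<lambda>i x. d i x + d' i x)"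
  unfolding diff_seq_def
proof (intro conjI allI ballI impI)
  fix i show "(\<lambda>x. d i x + d' i x) \<in> borel_measurable (S (Suc i))"
    using assms unfolding diff_seq_def by (intro borel_measurable_add) auto
next
  fix i A assume A: "A \<in> sets (S i)"
  have "integrable M (\<lambda>x. indicator A x * d i x)" "integrable M (\<lambda>x. indicator A x * d' i x)"
    using assms sets_S[OF A] by (auto simp: diff_seq_def intro!: integrable_indicator_mult_S[of _ "Suc i"])
  then show "(\<integral>x. indicator A x * (d i x + d' i x) \<partial>M) = 0"
    using assms A by (simp add: distrib_left diff_seq_def)
qed (use assms in \<open>auto simp: diff_seq_def\<close>)

lemma transform_measurable:
  assumes "\<And>i. d i \<in> borel_measurable (S (Suc i))" "N \<le> k"
  shows "(\<lambda>x. \<Sum>i<N. \<beta> i * d i x :: real) \<in> borel_measurable (S k)"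
proof (intro borel_measurable_sum borel_measurable_times borel_measurable_const)
  fix i assume "i \<in> {..<N}"
  then show "d i \<in> borel_measurable (S k)"
    using measurable_S_mono[OF _ assms(1), of i k] assms(2) by simp
qed

text \<open>Each increment from time \<open>k\<close> on integrates to zero over \<open>A\<close>,
  since \<open>A\<close> belongs to all later algebras.\<close>

lemma integral_indicator_transform:
  assumes d: "diff_seq n N a d" and A: "A \<in> sets (S k)"
  shows "(\<integral>x. indicator A x * (\<Sum>i<p + k. \<beta> i * d i x) \<partial>M) = (\<integral>x. indicator A x * (\<Sum>i<k. \<beta> i * d i x) \<partial>M)"
proof (induction p)
  case (Suc p)
  have meas: "d i \<in> borel_measurable (S (Suc i))" for i using d by (simp add: diff_seq_def)
  have "(\<integral>x. indicator A x * (\<Sum>i<Suc p + k. \<beta> i * d i x) \<partial>M)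
      = (\<integral>x. indicator A x * (\<Sum>i<p + k. \<beta> i * d i x) + \<beta> (p + k) * (indicator A x * d (p + k) x) \<partial>M)"
    by (simp add: distrib_left mult.left_commute)
  also have "\<dots> = (\<integral>x. indicator A x * (\<Sum>i<p + k. \<beta> i * d i x) \<partial>M)
      + \<beta> (p + k) * (\<integral>x. indicator A x * d (p + k) x \<partial>M)"
    using integrable_indicator_mult_S[OF meas sets_S[OF A]]
      integrable_indicator_mult_S[OF transform_measurable[OF meas order_refl] sets_S[OF A]]
    by simp
  also have "(\<integral>x. indicator A x * d (p + k) x \<partial>M) = 0"
    using d sets_S_mono[OF _ A, of "p + k"] by (simp add: diff_seq_def)
  finally show ?case using Suc by simp
qed simp

lemma transform_eventually_const:
  assumes d: "diff_seq n N a d" and "N \<le> k"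
  shows "(\<Sum>i<k. \<beta> i * d i x) = (\<Sum>i<N. \<beta> i * d i x)"
proof (rule sum.mono_neutral_right)
  have "d i x = 0" if "N \<le> i" for i using d that by (simp add: diff_seq_def)
  then show "\<forall>i\<in>{..<k} - {..<N}. \<beta> i * d i x = 0" by simp
qed (use \<open>N \<le> k\<close> in auto)

text \<open>The sign of the sum at time \<open>k\<close> is measurable at time \<open>k\<close>.
  Testing the final sum against this sign gives the norm at time \<open>k\<close> and at most the
  final norm.\<close>

lemma transform_L1_mono:
  assumes d: "diff_seq n N a d"
  shows "(\<integral>x. \<bar>\<Sum>i<k. \<beta> i * d i x\<bar> \<partial>M) \<le> (\<integral>x. \<bar>\<Sum>i<N. \<beta> i * d i x\<bar> \<partial>M)"
proof (cases "N \<le> k")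
  case True
  then show ?thesis using transform_eventually_const[OF d True] by simp
next
  case False
  define g where "g k x = (\<Sum>i<k. \<beta> i * d i x)" for k x
  have meas: "d i \<in> borel_measurable (S (Suc i))" for i using d by (simp add: diff_seq_def)
  have g: "g k \<in> borel_measurable (S k)" for k
    unfolding g_def by (rule transform_measurable[OF meas]) simp
  define P where "P = {x \<in> space (S k). 0 < g k x}"
  define Q where "Q = {x \<in> space (S k). g k x < 0}"
  have PQ: "P \<in> sets (S k)" "Q \<in> sets (S k)"
    unfolding P_def Q_def using g[of k] by measurable
  have *: "(\<integral>x. indicator A x * g N x \<partial>M) = (\<integral>x. indicator A x * g k x \<partial>M)" if "A \<in> sets (S k)" for A
    using integral_indicator_transform[OF d that, where p = "N - k" and \<beta> = \<beta>] False by (simp add: g_def)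
  have int: "integrable M (\<lambda>x. indicator A x * g j x)" if "A \<in> sets (S k)" for A j
    using integrable_indicator_mult_S[OF g] sets_S[OF that] by simp
  have "(\<integral>x. \<bar>g k x\<bar> \<partial>M) = (\<integral>x. indicator P x * g k x - indicator Q x * g k x \<partial>M)"
    by (rule Bochner_Integration.integral_cong) (auto simp: P_def Q_def space_S indicator_def)
  also have "\<dots> = (\<integral>x. indicator P x * g N x - indicator Q x * g N x \<partial>M)"
    using PQ by (simp add: int *)
  also have "\<dots> \<le> (\<integral>x. \<bar>g N x\<bar> \<partial>M)"
    using PQ by (intro integral_mono Bochner_Integration.integrable_diff int integrable_abs integrable_S[OF g])
      (auto simp: P_def Q_def indicator_def)
  finally show ?thesis by (simp add: g_def)
qed

text \<open>The index shift in the transform matches the convention for \<open>d i\<close>: the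
  increment from \<open>i\<close> to \<open>i + 1\<close> has weight
  \<open>\<beta> i\<close>.\<close>

lemma transform_partial_sums:
  "martingale_transform \<beta> (\<lambda>n x. \<Sum>i<n. d i x) n x = (\<Sum>i<n. \<beta> i * d i x)"
  unfolding martingale_transform_def by (induction n) auto

text \<open>The supremum is reached at the end \<open>N\<close> of the time window, which turns the
  norm into a single integral.\<close>

lemma norm_transform_partial_sums:
  assumes d: "diff_seq n N a d"
  shows "martingale_L1_norm M (martingale_transform \<beta> (\<lambda>n x. \<Sum>i<n. d i x))
    = ennreal (\<integral>x. \<bar>\<Sum>i<N. \<beta> i * d i x\<bar> \<partial>M)"
proof -
  have meas: "d i \<in> borel_measurable (S (Suc i))" for i using d by (simp add: diff_seq_def)
  have "(\<integral>\<^sup>+x. ennreal \<bar>\<Sum>i<k. \<beta> i * d i x\<bar> \<partial>M) = ennreal (\<integral>x. \<bar>\<Sum>i<k. \<beta> i * d i x\<bar> \<partial>M)" for k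
    by (intro nn_integral_eq_integral integrable_abs integrable_S[OF transform_measurable[OF meas]]) auto
  then have "martingale_L1_norm M (martingale_transform \<beta> (\<lambda>n x. \<Sum>i<n. d i x))
      = (SUP k. ennreal (\<integral>x. \<bar>\<Sum>i<k. \<beta> i * d i x\<bar> \<partial>M))"
    by (simp add: martingale_L1_norm_def transform_partial_sums)
  also have "\<dots> = ennreal (\<integral>x. \<bar>\<Sum>i<N. \<beta> i * d i x\<bar> \<partial>M)"
    by (intro antisym SUP_least SUP_upper ennreal_leI transform_L1_mono[OF d]) auto
  finally show ?thesis .
qed

lemma L1_martingale_partial_sums:
  assumes d: "diff_seq n N a d"
  shows "L1_martingale M S (\<lambda>n x. \<Sum>i<n. d i x)"
proof -
  have meas: "d i \<in> borel_measurable (S (Suc i))" for i using d by (simp add: diff_seq_def)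
  have f: "(\<lambda>x. \<Sum>i<k. d i x) \<in> borel_measurable (S k)" for k
    using transform_measurable[OF meas order_refl, where \<beta> = "\<lambda>_. 1"] by simp
  have "AE x in M. real_cond_exp M (S i) (\<lambda>x. \<Sum>i<j. d i x) x = (\<Sum>j<i. d j x)" if "i \<le> j" for i j
  proof -
    interpret F: finite_measure_subalgebra M "S i"
      by unfold_locales (rule subalgebra_S)
    show ?thesis
    proof (rule F.real_cond_exp_charact[OF _ integrable_S[OF f] integrable_S[OF f] f])
      fix A assume "A \<in> sets (S i)"
      from integral_indicator_transform[OF d this, where p = "j - i" and \<beta> = "\<lambda>_. 1"] that
      show "(\<integral>x\<in>A. (\<Sum>i<j. d i x) \<partial>M) = (\<integral>x\<in>A. (\<Sum>j<i. d j x) \<partial>M)"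
        by (simp add: set_lebesgue_integral_def)
    qed
  qed
  moreover have "martingale_L1_norm M (\<lambda>n x. \<Sum>i<n. d i x) < \<infinity>"
  proof -
    \<comment> \<open>With all weights 1 the transform returns the martingale itself, because it
      starts at 0.\<close>
    have "martingale_transform (\<lambda>_. 1) (\<lambda>n x. \<Sum>i<n. d i x) = (\<lambda>n x. \<Sum>i<n. d i x)"
      by (simp add: fun_eq_iff transform_partial_sums)
    then show ?thesis using norm_transform_partial_sums[OF d, of "\<lambda>_. 1"] by simp
  qed
  ultimately show ?thesis
    unfolding L1_martingale_def martingale_def using f integrable_S[OF f] by blast
qed

end

subsection \<open>The Bellman function of the inequality\<close>

definition penalty :: "real \<Rightarrow> nat \<Rightarrow> (nat \<Rightarrow> real) \<Rightarrow> real" where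
  "penalty C l y = C * (\<Sum>j=2..l. \<bar>y j\<bar>) - \<bar>y 1\<bar>"

text \<open>For \<open>0 \<le> C\<close> this is a seminorm controlling the change of
  \<open>penalty\<close> under translation; it serves as the Lipschitz modulus.\<close>

definition penalty_norm :: "real \<Rightarrow> nat \<Rightarrow> (nat \<Rightarrow> real) \<Rightarrow> real" where
  "penalty_norm C l y = C * (\<Sum>j=2..l. \<bar>y j\<bar>) + \<bar>y 1\<bar>"

lemma penalty_cong:
  assumes "l \<ge> 1" "\<And>j. j \<in> {1..l} \<Longrightarrow> y j = z j"
  shows "penalty C l y = penalty C l z"
  using assms by (simp add: penalty_def)

lemma penalty_scale: "0 \<le> r \<Longrightarrow> penalty C l (\<lambda>j. r * y j) = r * penalty C l y"
  by (simp add: penalty_def abs_mult sum_distrib_left right_diff_distrib mult.left_commute)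

lemma penalty_le_add_norm:
  assumes "0 \<le> C"
  shows "penalty C l y \<le> penalty C l z + penalty_norm C l (\<lambda>j. y j - z j)"
proof -
  have "(\<Sum>j=2..l. \<bar>y j\<bar>) \<le> (\<Sum>j=2..l. \<bar>z j\<bar> + \<bar>y j - z j\<bar>)"
    by (intro sum_mono) arith
  then have "C * (\<Sum>j=2..l. \<bar>y j\<bar>) \<le> C * (\<Sum>j=2..l. \<bar>z j\<bar>) + C * (\<Sum>j=2..l. \<bar>y j - z j\<bar>)"
    using mult_left_mono[OF _ assms] by (simp add: sum.distrib flip: distrib_left)
  then show ?thesis unfolding penalty_def penalty_norm_def by linarith
qed

lemma penalty_norm_sum:
  assumes "0 \<le> C"
  shows "penalty_norm C l (\<lambda>j. \<Sum>k<m. x k * a j k) \<le> (\<Sum>k<m. \<bar>x k\<bar> * penalty_norm C l (\<lambda>j. a j k))"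
proof -
  have *: "\<bar>\<Sum>k<m. x k * a j k\<bar> \<le> (\<Sum>k<m. \<bar>x k\<bar> * \<bar>a j k\<bar>)" for j
    by (rule order_trans[OF sum_abs]) (simp add: abs_mult)
  have "(\<Sum>j=2..l. \<bar>\<Sum>k<m. x k * a j k\<bar>) \<le> (\<Sum>j=2..l. \<Sum>k<m. \<bar>x k\<bar> * \<bar>a j k\<bar>)"
    by (intro sum_mono *)
  also have "\<dots> = (\<Sum>k<m. \<bar>x k\<bar> * (\<Sum>j=2..l. \<bar>a j k\<bar>))"
    by (subst sum.swap) (simp add: sum_distrib_left)
  finally have "C * (\<Sum>j=2..l. \<bar>\<Sum>k<m. x k * a j k\<bar>) \<le> C * (\<Sum>k<m. \<bar>x k\<bar> * (\<Sum>j=2..l. \<bar>a j k\<bar>))"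
    using assms by (rule mult_left_mono)
  also have "\<dots> = (\<Sum>k<m. \<bar>x k\<bar> * (C * (\<Sum>j=2..l. \<bar>a j k\<bar>)))"
    by (simp add: sum_distrib_left mult.left_commute)
  finally show ?thesis
    using *[of 1] by (simp add: penalty_norm_def distrib_left sum.distrib)
qed

lemma penalty_norm_nonneg: "0 \<le> C \<Longrightarrow> 0 \<le> penalty_norm C l y"
  by (simp add: penalty_norm_def sum_nonneg)

locale transform_inequality = finite_filtered_space +
  fixes C :: real and l m :: nat and \<alpha> :: "nat \<Rightarrow> nat \<Rightarrow> real"
  assumes grows: "grows_uniformly M S"
    and C_nonneg: "0 \<le> C" and l: "l \<ge> 1" and m: "m \<ge> 1"
    and periodic: "\<And>j n. j \<in> {1..l} \<Longrightarrow> \<alpha> j (n + m) = \<alpha> j n"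
    and ineq: "\<And>f. L1_martingale M S f \<Longrightarrow> martingale_L1_norm M (martingale_transform (\<alpha> 1) f)
                 \<le> ennreal C * (\<Sum>j=2..l. martingale_L1_norm M (martingale_transform (\<alpha> j) f))"
begin

section \<open>Costs of strategies on a set\<close>

text \<open>Existence of a strategy is recorded instead of an infimum, so strategies can be glued
  without choosing near-minimizers. Costs are integrals, not averages, so they add over disjoint
  sets.\<close>

definition cost_bound :: "nat \<Rightarrow> 'a set \<Rightarrow> (nat \<Rightarrow> real) \<Rightarrow> real \<Rightarrow> bool" where
  "cost_bound n a y r \<longleftrightarrow> (\<exists>N d. diff_seq n N a d \<and>
     (\<integral>x. indicator a x * penalty C l (\<lambda>j. y j + (\<Sum>i<N. \<alpha> j i * d i x)) \<partial>M) \<le> r)"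

lemma penalty_transform_measurable:
  assumes "diff_seq n N a d"
  shows "(\<lambda>x. penalty C l (\<lambda>j. y j + (\<Sum>i<N. \<alpha> j i * d i x))) \<in> borel_measurable (S N)"
proof -
  have "(\<lambda>x. \<Sum>i<N. \<alpha> j i * d i x) \<in> borel_measurable (S N)" for j
    using assms by (intro transform_measurable) (auto simp: diff_seq_def)
  then have [measurable]: "(\<lambda>x. y j + (\<Sum>i<N. \<alpha> j i * d i x)) \<in> borel_measurable (S N)" for j
    by (intro borel_measurable_add) auto
  show ?thesis unfolding penalty_def by measurable
qed

lemma integrable_penalty_transform:
  assumes "diff_seq n N a d" "A \<in> sets M"
  shows "integrable M (\<lambda>x. indicator A x * penalty C l (\<lambda>j. y j + (\<Sum>i<N. \<alpha> j i * d i x)))"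
  by (rule integrable_indicator_mult_S[OF penalty_transform_measurable[OF assms(1)] assms(2)])

lemma cost_bound_mono: "cost_bound n a y r \<Longrightarrow> r \<le> r' \<Longrightarrow> cost_bound n a y r'"
  unfolding cost_bound_def by (meson order_trans)

lemma cost_bound_earlier: "cost_bound n' a y r \<Longrightarrow> n \<le> n' \<Longrightarrow> cost_bound n a y r"
  unfolding cost_bound_def by (meson diff_seq_weaken order_refl)

text \<open>Needed because periodicity, which allows replacing a time by its residue, is given only
  for \<open>j \<in> {1..l}\<close>.\<close>

lemma cost_bound_cong:
  assumes "\<And>j. j \<in> {1..l} \<Longrightarrow> y j = z j"
  shows "cost_bound n a y r \<longleftrightarrow> cost_bound n a z r"
proof -
  have "(\<lambda>x. indicator a x * penalty C l (\<lambda>j. y j + (\<Sum>i<N. \<alpha> j i * d i x)))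
      = (\<lambda>x. indicator a x * penalty C l (\<lambda>j. z j + (\<Sum>i<N. \<alpha> j i * d i x)))" for N and d :: "nat \<Rightarrow> 'a \<Rightarrow> real"
    using assms by (intro ext arg_cong[where f = "(*) _"] penalty_cong l) auto
  then show ?thesis unfolding cost_bound_def by presburger
qed

lemma cost_bound_penalty:
  assumes "a \<in> sets M"
  shows "cost_bound n a y (penalty C l y * measure M a)"
  unfolding cost_bound_def
proof (intro exI conjI)
  show "diff_seq n 0 a (\<lambda>_ _. 0)" by (rule diff_seq_zero)
qed (use assms in \<open>simp add: mult.commute\<close>)

text \<open>The same increments are played from the new starting point; the penalties are compared
  pointwise.\<close>

lemma cost_bound_shift:
  assumes "cost_bound n a y r" "a \<in> sets M"
  shows "cost_bound n a z (r + penalty_norm C l (\<lambda>j. z j - y j) * measure M a)"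
proof -
  obtain N d where d: "diff_seq n N a d"
    and r: "(\<integral>x. indicator a x * penalty C l (\<lambda>j. y j + (\<Sum>i<N. \<alpha> j i * d i x)) \<partial>M) \<le> r"
    using assms by (auto simp: cost_bound_def)
  have "(\<integral>x. indicator a x * penalty C l (\<lambda>j. z j + (\<Sum>i<N. \<alpha> j i * d i x)) \<partial>M)
    \<le> (\<integral>x. indicator a x * penalty C l (\<lambda>j. y j + (\<Sum>i<N. \<alpha> j i * d i x))
          + penalty_norm C l (\<lambda>j. z j - y j) * indicator a x \<partial>M)"
  proof (rule integral_mono)
    fix x
    show "indicator a x * penalty C l (\<lambda>j. z j + (\<Sum>i<N. \<alpha> j i * d i x))
      \<le> indicator a x * penalty C l (\<lambda>j. y j + (\<Sum>i<N. \<alpha> j i * d i x))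
          + penalty_norm C l (\<lambda>j. z j - y j) * indicator a x"
      using penalty_le_add_norm[OF C_nonneg, of l "\<lambda>j. z j + (\<Sum>i<N. \<alpha> j i * d i x)" "\<lambda>j. y j + (\<Sum>i<N. \<alpha> j i * d i x)"]
      by (simp add: indicator_def)
  qed (use d assms(2) in \<open>auto intro!: integrable_penalty_transform Bochner_Integration.integrable_add integrable_mult_right integrable_indicator_event\<close>)
  also have "\<dots> \<le> r + penalty_norm C l (\<lambda>j. z j - y j) * measure M a"
    using r assms(2) integrable_penalty_transform[OF d assms(2), of y] integrable_indicator_event[OF assms(2)]
    by (subst Bochner_Integration.integral_add) auto
  finally show ?thesis using d by (auto simp: cost_bound_def)
qed

lemma cost_bound_scale:
  assumes "cost_bound n a y r" "0 < q"
  shows "cost_bound n a (\<lambda>j. q * y j) (q * r)"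
proof -
  obtain N d where d: "diff_seq n N a d"
    and r: "(\<integral>x. indicator a x * penalty C l (\<lambda>j. y j + (\<Sum>i<N. \<alpha> j i * d i x)) \<partial>M) \<le> r"
    using assms by (auto simp: cost_bound_def)
  have "(\<lambda>j. q * y j + (\<Sum>i<N. \<alpha> j i * (q * d i x))) = (\<lambda>j. q * (y j + (\<Sum>i<N. \<alpha> j i * d i x)))" for x
    by (simp add: distrib_left sum_distrib_left mult.left_commute)
  then have "(\<integral>x. indicator a x * penalty C l (\<lambda>j. q * y j + (\<Sum>i<N. \<alpha> j i * (q * d i x))) \<partial>M)
      = q * (\<integral>x. indicator a x * penalty C l (\<lambda>j. y j + (\<Sum>i<N. \<alpha> j i * d i x)) \<partial>M)"
    using \<open>0 < q\<close> by (simp add: penalty_scale mult.left_commute)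
  also have "\<dots> \<le> q * r" using r \<open>0 < q\<close> by simp
  finally show ?thesis unfolding cost_bound_def using diff_seq_scale[OF d, of q] by blast
qed

text \<open>With \<open>t = u = 0\<close> this glues strategies on disjoint sets; otherwise the martingale first jumps
  by \<open>t\<close> on \<open>b\<close> and by \<open>u\<close> on \<open>c\<close> at time \<open>n\<close>.\<close>
lemma cost_bound_split:
  assumes n': "n \<le> n'" and b: "b \<in> sets (S n')" and c: "c \<in> sets (S n')" and disj: "b \<inter> c = {}"
    and e_meas: "(\<lambda>x. t * indicator b x + u * indicator c x) \<in> borel_measurable (S (Suc n))"
    and e_zero: "\<And>A. A \<in> sets (S n) \<Longrightarrow> t * measure M (A \<inter> b) + u * measure M (A \<inter> c) = 0"
    and costs: "cost_bound n' b (\<lambda>j. y j + t * \<alpha> j n) r" "cost_bound n' c (\<lambda>j. y j + u * \<alpha> j n) r'"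
  shows "cost_bound n (b \<union> c) y (r + r')"
proof -
  obtain N1 d1 where d1: "diff_seq n' N1 b d1"
    and r: "(\<integral>x. indicator b x * penalty C l (\<lambda>j. y j + t * \<alpha> j n + (\<Sum>i<N1. \<alpha> j i * d1 i x)) \<partial>M) \<le> r"
    using costs(1) unfolding cost_bound_def by blast
  obtain N2 d2 where d2: "diff_seq n' N2 c d2"
    and r': "(\<integral>x. indicator c x * penalty C l (\<lambda>j. y j + u * \<alpha> j n + (\<Sum>i<N2. \<alpha> j i * d2 i x)) \<partial>M) \<le> r'"
    using costs(2) unfolding cost_bound_def by blast
  have bc: "b \<in> sets M" "c \<in> sets M" using sets_S b c by auto
  \<comment> \<open>A common horizon for both strategies that also covers the jump at time
    \<open>n\<close>.\<close>
  define N where "N = Max {N1, N2, Suc n}"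
  have N: "N1 \<le> N" "N2 \<le> N" "Suc n \<le> N" by (auto simp: N_def)
  define e where "e i x = (if i = n then t * indicator b x + u * indicator c x else (0::real))" for i x
  define d where "d i x = e i x + (d1 i x + d2 i x)" for i x
  have "diff_seq n N (b \<union> c) e"
    unfolding diff_seq_def
  proof (intro conjI allI ballI impI)
    fix i show "e i \<in> borel_measurable (S (Suc i))"
      using e_meas by (cases "i = n") (simp_all add: e_def[abs_def])
  next
    fix i A assume A: "A \<in> sets (S i)"
    show "(\<integral>x. indicator A x * e i x \<partial>M) = 0"
    proof (cases "i = n")
      case True
      have "indicator A x * e i x = t * indicator (A \<inter> b) x + u * indicator (A \<inter> c) x" for x
        using True by (simp add: e_def indicator_def)
      then show ?thesis using e_zero[of A] A True sets_S[OF A] bc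
        by (simp add: integrable_indicator_event Bochner_Integration.integral_add)
    qed (simp add: e_def)
  qed (use N in \<open>auto simp: e_def\<close>)
  moreover have "diff_seq n N (b \<union> c) d1" "diff_seq n N (b \<union> c) d2"
    using N n' by (auto intro: diff_seq_weaken[OF d1] diff_seq_weaken[OF d2])
  ultimately have "diff_seq n N (b \<union> c) d"
    unfolding d_def[abs_def] by (rule diff_seq_add[OF _ diff_seq_add])
  moreover have "(\<integral>x. indicator (b \<union> c) x * penalty C l (\<lambda>j. y j + (\<Sum>i<N. \<alpha> j i * d i x)) \<partial>M) \<le> r + r'"
  proof -
    have sum_N: "(\<Sum>i<N. \<alpha> j i * d1 i x) = (\<Sum>i<N1. \<alpha> j i * d1 i x)"
      "(\<Sum>i<N. \<alpha> j i * d2 i x) = (\<Sum>i<N2. \<alpha> j i * d2 i x)" for j x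
      using transform_eventually_const[OF d1 N(1)] transform_eventually_const[OF d2 N(2)] by auto
    have sum_e: "(\<Sum>i<N. \<alpha> j i * e i x) = (t * indicator b x + u * indicator c x) * \<alpha> j n" for j x
    proof -
      have "(\<Sum>i<N. \<alpha> j i * e i x) = (\<Sum>i<N. if i = n then (t * indicator b x + u * indicator c x) * \<alpha> j n else 0)"
        by (intro sum.cong) (auto simp: e_def)
      then show ?thesis using N by simp
    qed
    have zero: "x \<notin> b \<Longrightarrow> d1 i x = 0" "x \<notin> c \<Longrightarrow> d2 i x = 0" for i x
      using d1 d2 by (auto simp: diff_seq_def)
    have "indicator (b \<union> c) x * penalty C l (\<lambda>j. y j + (\<Sum>i<N. \<alpha> j i * d i x))
      = indicator b x * penalty C l (\<lambda>j. y j + t * \<alpha> j n + (\<Sum>i<N1. \<alpha> j i * d1 i x))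
      + indicator c x * penalty C l (\<lambda>j. y j + u * \<alpha> j n + (\<Sum>i<N2. \<alpha> j i * d2 i x))" for x
    proof -
      have *: "(\<Sum>i<N. \<alpha> j i * d i x) = (t * indicator b x + u * indicator c x) * \<alpha> j n
          + ((\<Sum>i<N1. \<alpha> j i * d1 i x) + (\<Sum>i<N2. \<alpha> j i * d2 i x))" for j
        unfolding d_def by (simp only: distrib_left sum.distrib sum_e sum_N)
      consider "x \<in> b" "x \<notin> c" | "x \<notin> b" "x \<in> c" | "x \<notin> b" "x \<notin> c" using disj by blast
      then show ?thesis by cases (simp_all add: * zero add.assoc)
    qed
    then have "(\<integral>x. indicator (b \<union> c) x * penalty C l (\<lambda>j. y j + (\<Sum>i<N. \<alpha> j i * d i x)) \<partial>M)
      = (\<integral>x. indicator b x * penalty C l (\<lambda>j. y j + t * \<alpha> j n + (\<Sum>i<N1. \<alpha> j i * d1 i x)) \<partial>M)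
      + (\<integral>x. indicator c x * penalty C l (\<lambda>j. y j + u * \<alpha> j n + (\<Sum>i<N2. \<alpha> j i * d2 i x)) \<partial>M)"
      using integrable_penalty_transform[OF d1 bc(1)] integrable_penalty_transform[OF d2 bc(2)]
      by (simp add: Bochner_Integration.integral_add)
    then show ?thesis using r r' by simp
  qed
  ultimately show ?thesis unfolding cost_bound_def by blast
qed

text \<open>Strategies on the atoms are glued with zero jumps; the costs add up as the measures
  do.\<close>

lemma cost_bound_atoms:
  assumes "a \<in> sets (S n)"
    and atoms: "\<And>b. b \<in> atoms_of (S n) \<Longrightarrow> cost_bound n b y (w * measure M b)"
  shows "cost_bound n a y (w * measure M a)"
  using assms(1)
proof (induction rule: sets_S_induct)
  case empty
  then show ?case using cost_bound_penalty[of "{}" n y] by simp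
next
  case (Un b B)
  have "b \<in> sets (S n)" using Un by (simp add: atoms_of_def)
  then have "cost_bound n (b \<union> B) y (w * measure M b + w * measure M B)"
    using Un atoms by (intro cost_bound_split[of n n b B 0 0]) auto
  moreover have "measure M (b \<union> B) = measure M b + measure M B"
    using Un \<open>b \<in> sets (S n)\<close> sets_S by (intro finite_measure_Union) auto
  ultimately show ?case by (simp add: distrib_left)
qed

text \<open>Demanding the bound for all starting times and all sets makes the value depend on \<open>y\<close> only, so
  that one may wait for the next time with a prescribed residue modulo \<open>m\<close>.\<close>
definition attainable :: "(nat \<Rightarrow> real) \<Rightarrow> real \<Rightarrow> bool" where
  "attainable y w \<longleftrightarrow> (\<forall>n. \<forall>a\<in>sets (S n). cost_bound n a y (w * measure M a))"

text \<open>The infimum is genuine: \<open>attainable_penalty\<close> shows the set nonempty and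
  \<open>attainable_lower_bound\<close> bounds it below.\<close>

definition bellman :: "(nat \<Rightarrow> real) \<Rightarrow> real" where
  "bellman y = Inf {w. attainable y w}"

lemma attainable_penalty: "attainable y (penalty C l y)"
  unfolding attainable_def using cost_bound_penalty sets_S by blast

lemma attainable_mono: "attainable y w \<Longrightarrow> w \<le> w' \<Longrightarrow> attainable y w'"
  unfolding attainable_def by (meson cost_bound_mono measure_nonneg mult_right_mono)

lemma attainable_shift:
  assumes "attainable y w"
  shows "attainable z (w + penalty_norm C l (\<lambda>j. z j - y j))"
  unfolding attainable_def
proof (intro allI ballI)
  fix n a assume a: "a \<in> sets (S n)"
  then have "cost_bound n a y (w * measure M a)" using assms by (simp add: attainable_def)
  from cost_bound_shift[OF this sets_S[OF a], of z]
  show "cost_bound n a z ((w + penalty_norm C l (\<lambda>j. z j - y j)) * measure M a)"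
    by (simp add: distrib_right)
qed

lemma attainable_scale:
  assumes "attainable y w" "0 < q"
  shows "attainable (\<lambda>j. q * y j) (q * w)"
  unfolding attainable_def
proof (intro allI ballI)
  fix n a assume "a \<in> sets (S n)"
  then have "cost_bound n a y (w * measure M a)" using assms by (simp add: attainable_def)
  from cost_bound_scale[OF this \<open>0 < q\<close>]
  show "cost_bound n a (\<lambda>j. q * y j) (q * w * measure M a)" by (simp add: mult.assoc)
qed

section \<open>Lower bound and elementary properties of the Bellman function\<close>

text \<open>This is where the assumed inequality enters: applied to the martingale of partial sums,
  it compares integrals of the final sums.\<close>

lemma penalty_transform_nonneg:
  assumes d: "diff_seq n N a d"
  shows "0 \<le> (\<integral>x. penalty C l (\<lambda>j. \<Sum>i<N. \<alpha> j i * d i x) \<partial>M)"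
proof -
  let ?I = "\<lambda>j. \<integral>x. \<bar>\<Sum>i<N. \<alpha> j i * d i x\<bar> \<partial>M"
  have "ennreal (?I 1) \<le> ennreal C * (\<Sum>j=2..l. ennreal (?I j))"
    using ineq[OF L1_martingale_partial_sums[OF d]] by (simp add: norm_transform_partial_sums[OF d])
  also have "\<dots> = ennreal (C * (\<Sum>j=2..l. ?I j))"
    using C_nonneg by (simp add: sum_ennreal ennreal_mult sum_nonneg)
  finally have "?I 1 \<le> C * (\<Sum>j=2..l. ?I j)"
    using C_nonneg by (subst (asm) ennreal_le_iff) (auto intro!: mult_nonneg_nonneg sum_nonneg)
  moreover have "integrable M (\<lambda>x. \<bar>\<Sum>i<N. \<alpha> j i * d i x\<bar>)" for j
    using d by (intro integrable_abs integrable_S[OF transform_measurable]) (auto simp: diff_seq_def)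
  then have "(\<integral>x. penalty C l (\<lambda>j. \<Sum>i<N. \<alpha> j i * d i x) \<partial>M) = C * (\<Sum>j=2..l. ?I j) - ?I 1"
    by (simp add: penalty_def)
  ultimately show ?thesis by simp
qed

text \<open>A strategy on the whole space is moved to the origin, where its cost is nonnegative; the
  move costs at most the seminorm of \<open>y\<close>.\<close>

lemma attainable_lower_bound:
  assumes "attainable y w"
  shows "- penalty_norm C l y \<le> w"
proof -
  have "attainable (\<lambda>_. 0) (w + penalty_norm C l (\<lambda>j. 0 - y j))"
    by (rule attainable_shift[OF assms])
  moreover have "space M \<in> sets (S 0)" using sets.top[of "S 0"] by (simp add: space_S)
  ultimately have "cost_bound 0 (space M) (\<lambda>_. 0) (w + penalty_norm C l (\<lambda>j. 0 - y j))"
    unfolding attainable_def using prob_space by fastforce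
  then obtain N d where d: "diff_seq 0 N (space M) d" and
    "(\<integral>x. indicator (space M) x * penalty C l (\<lambda>j. \<Sum>i<N. \<alpha> j i * d i x) \<partial>M) \<le> w + penalty_norm C l (\<lambda>j. 0 - y j)"
    unfolding cost_bound_def by auto
  moreover have "(\<integral>x. indicator (space M) x * penalty C l (\<lambda>j. \<Sum>i<N. \<alpha> j i * d i x) \<partial>M)
      = (\<integral>x. penalty C l (\<lambda>j. \<Sum>i<N. \<alpha> j i * d i x) \<partial>M)"
    by (rule Bochner_Integration.integral_cong) auto
  ultimately have "0 \<le> w + penalty_norm C l (\<lambda>j. 0 - y j)"
    using penalty_transform_nonneg[OF d] by simp
  then show ?thesis by (simp add: penalty_norm_def)
qed

lemma bellman_le: "attainable y w \<Longrightarrow> bellman y \<le> w"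
  unfolding bellman_def using attainable_lower_bound by (intro cInf_lower bdd_belowI) auto

lemma attainable_if_bellman_less:
  assumes "bellman y < w"
  shows "attainable y w"
proof -
  obtain v where "attainable y v" "v < w"
    using cInf_lessD[of "{w. attainable y w}" w] attainable_penalty assms unfolding bellman_def by auto
  then show ?thesis using attainable_mono[of y v w] by simp
qed

lemma bellman_le_penalty: "bellman y \<le> penalty C l y"
  by (rule bellman_le[OF attainable_penalty])

lemma bellman_le_add_norm: "bellman z \<le> bellman y + penalty_norm C l (\<lambda>j. z j - y j)"
proof (rule field_le_epsilon)
  fix \<epsilon> :: real assume "0 < \<epsilon>"
  then have "attainable y (bellman y + \<epsilon>)" by (intro attainable_if_bellman_less) simp
  from bellman_le[OF attainable_shift[OF this, of z]]
  show "bellman z \<le> bellman y + penalty_norm C l (\<lambda>j. z j - y j) + \<epsilon>" by simp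
qed

lemma bellman_scale_le:
  assumes "0 < q"
  shows "bellman (\<lambda>j. q * y j) \<le> q * bellman y"
proof (rule field_le_epsilon)
  fix \<epsilon> :: real assume "0 < \<epsilon>"
  then have "attainable y (bellman y + \<epsilon> / q)" using assms by (intro attainable_if_bellman_less) simp
  from bellman_le[OF attainable_scale[OF this assms]]
  show "bellman (\<lambda>j. q * y j) \<le> q * bellman y + \<epsilon>" using assms by (simp add: distrib_left)
qed

lemma bellman_scale:
  assumes "0 < q"
  shows "bellman (\<lambda>j. q * y j) = q * bellman y"
proof (rule antisym[OF bellman_scale_le[OF assms]])
  have "bellman (\<lambda>j. (1 / q) * (q * y j)) \<le> (1 / q) * bellman (\<lambda>j. q * y j)"
    using assms by (intro bellman_scale_le) simp
  then show "q * bellman y \<le> bellman (\<lambda>j. q * y j)" using assms by (simp add: field_simps)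
qed

lemma periodic_mult: "j \<in> {1..l} \<Longrightarrow> \<alpha> j (n * m + k) = \<alpha> j k"
proof (induction n)
  case (Suc n)
  then show ?case using periodic[of j "n * m + k"] by (simp add: ac_simps)
qed simp

section \<open>Convexity of the Bellman function along the directions of the increments\<close>

text \<open>Strategy: wait for a time with the coefficients of time \<open>k\<close>, split every
  atom in two, jump by \<open>(1 - p) * s\<close> or \<open>- p * s\<close>, then continue almost
  optimally. The ratio \<open>p\<close> depends on the atom, so the premise covers the whole range;
  its strictness pays for near-optimality.\<close>

lemma bellman_weakly_convex:
  obtains \<delta> where "0 < \<delta>"
    "\<And>y s w k. (\<And>p. \<delta> \<le> p \<Longrightarrow> p \<le> 1 - \<delta> \<Longrightarrow>
        p * bellman (\<lambda>j. y j + (1 - p) * s * \<alpha> j k) + (1 - p) * bellman (\<lambda>j. y j - p * s * \<alpha> j k) < w)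
      \<Longrightarrow> bellman y \<le> w"
proof -
  obtain \<delta> where "0 < \<delta>" and \<delta>: "\<And>n a. a \<in> atoms_of (S n) \<Longrightarrow> \<exists>b\<in>sets (S (Suc n)). b \<subseteq> a \<and>
       \<delta> * measure M a \<le> measure M b \<and> measure M b \<le> (1 - \<delta>) * measure M a"
    using balanced_split[OF grows] by blast
  have "bellman y \<le> w"
    if less: "\<And>p. \<delta> \<le> p \<Longrightarrow> p \<le> 1 - \<delta> \<Longrightarrow>
        p * bellman (\<lambda>j. y j + (1 - p) * s * \<alpha> j k) + (1 - p) * bellman (\<lambda>j. y j - p * s * \<alpha> j k) < w"
    for y s w k
  proof -
    have atom: "cost_bound n a y (w * measure M a)"
      if n: "\<And>j. j \<in> {1..l} \<Longrightarrow> \<alpha> j n = \<alpha> j k" and a: "a \<in> atoms_of (S n)" for n a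
    \<comment> \<open>On a null atom the ratio \<open>p\<close> would be meaningless, but every cost
      bound there is a bound by 0.\<close>
    proof (cases "measure M a = 0")
      case True
      then show ?thesis using cost_bound_penalty[of a n y] a sets_S by (auto simp: atoms_of_def)
    next
      case False
      then have a_pos: "0 < measure M a" using measure_nonneg[of M a] by linarith
      have aS: "a \<in> sets (S n)" using a by (simp add: atoms_of_def)
      obtain b where b: "b \<in> sets (S (Suc n))" "b \<subseteq> a"
        "\<delta> * measure M a \<le> measure M b" "measure M b \<le> (1 - \<delta>) * measure M a"
        using \<delta>[OF a] by blast
      define c where "c = a - b"
      have c: "c \<in> sets (S (Suc n))" "b \<inter> c = {}" "b \<union> c = a"
        using b sets_S_mono[OF _ aS, of "Suc n"] by (auto simp: c_def)
      define p where "p = measure M b / measure M a"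
      have p: "\<delta> \<le> p" "p \<le> 1 - \<delta>" using b a_pos by (auto simp: p_def field_simps)
      have mb: "measure M b = p * measure M a" using a_pos by (simp add: p_def)
      have "measure M c = measure M a - measure M b"
        unfolding c_def using b sets_S aS by (intro finite_measure_Diff) auto
      then have mc: "measure M c = (1 - p) * measure M a" by (simp add: mb left_diff_distrib)
      define y1 where "y1 = (\<lambda>j. y j + (1 - p) * s * \<alpha> j k)"
      define y2 where "y2 = (\<lambda>j. y j - p * s * \<alpha> j k)"
      \<comment> \<open>The slack in the premise: adding it to both Bellman values makes their
        \<open>p\<close>-mean exactly \<open>w\<close>.\<close>
      define \<eta> where "\<eta> = w - (p * bellman y1 + (1 - p) * bellman y2)"
      have "0 < \<eta>" using less[OF p] by (simp add: \<eta>_def y1_def y2_def)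
      then have "attainable y1 (bellman y1 + \<eta>)" "attainable y2 (bellman y2 + \<eta>)"
        by (auto intro: attainable_if_bellman_less)
      then have "cost_bound (Suc n) b y1 ((bellman y1 + \<eta>) * measure M b)"
        "cost_bound (Suc n) c y2 ((bellman y2 + \<eta>) * measure M c)"
        using b c by (auto simp: attainable_def)
      moreover have "cost_bound (Suc n) b y1 r = cost_bound (Suc n) b (\<lambda>j. y j + (1 - p) * s * \<alpha> j n) r"
        "cost_bound (Suc n) c y2 r = cost_bound (Suc n) c (\<lambda>j. y j + (- p * s) * \<alpha> j n) r" for r
        using n by (auto simp: y1_def y2_def intro!: cost_bound_cong)
      ultimately have costs: "cost_bound (Suc n) b (\<lambda>j. y j + (1 - p) * s * \<alpha> j n) ((bellman y1 + \<eta>) * measure M b)"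
        "cost_bound (Suc n) c (\<lambda>j. y j + (- p * s) * \<alpha> j n) ((bellman y2 + \<eta>) * measure M c)"
        by auto
      have "cost_bound n (b \<union> c) y ((bellman y1 + \<eta>) * measure M b + (bellman y2 + \<eta>) * measure M c)"
      proof (rule cost_bound_split[OF _ b(1) c(1,2) _ _ costs])
        show "(\<lambda>x. (1 - p) * s * indicator b x + (- p * s) * indicator c x) \<in> borel_measurable (S (Suc n))"
          using b(1) c(1) by measurable
        fix A assume A: "A \<in> sets (S n)"
        \<comment> \<open>A set known at time \<open>n\<close> contains the atom or misses it, so
          the mean-zero condition has to be checked on all of \<open>a\<close> only.\<close>
        then have "A \<inter> a = {} \<or> A \<inter> a = a"
          using a aS by (auto simp: atoms_of_def)
        then have "A \<inter> b = {} \<and> A \<inter> c = {} \<or> A \<inter> b = b \<and> A \<inter> c = c"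
          using c(3) by blast
        then show "(1 - p) * s * measure M (A \<inter> b) + (- p * s) * measure M (A \<inter> c) = 0"
          by (auto simp: mb mc)
      qed simp
      moreover have "(bellman y1 + \<eta>) * measure M b + (bellman y2 + \<eta>) * measure M c = w * measure M a"
        unfolding mb mc \<eta>_def by (simp add: algebra_simps)
      ultimately show ?thesis by (simp add: c(3))
    qed
    have "attainable y w"
      unfolding attainable_def
    proof (intro allI ballI)
      fix n a assume a: "a \<in> sets (S n)"
      \<comment> \<open>\<open>n * m + k\<close> is a time not before \<open>n\<close> with the
        coefficients of \<open>k\<close>; a strategy starting then is also one starting at
        \<open>n\<close>.\<close>
      have le: "n \<le> n * m + k" using m by (simp add: trans_le_add1)
      have "cost_bound (n * m + k) a y (w * measure M a)"
        using sets_S_mono[OF le a] by (rule cost_bound_atoms) (rule atom[OF periodic_mult])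
      then show "cost_bound n a y (w * measure M a)" using le by (rule cost_bound_earlier)
    qed
    then show ?thesis by (rule bellman_le)
  qed
  then show ?thesis using that \<open>0 < \<delta>\<close> by blast
qed

text \<open>Points of the span are parametrized by coefficients \<open>x\<close>, so increments
  become moves of single coordinates. Injectivity plays no part, and linearly dependent directions
  are allowed.\<close>

lemma hom_sep_convex_bellman:
  obtains K where "hom_sep_convex m K (\<lambda>x. bellman (\<lambda>j. \<Sum>k<m. x k * \<alpha> j k))"
proof -
  let ?W = "\<lambda>x. bellman (\<lambda>j. \<Sum>k<m. x k * \<alpha> j k)"
  define K where "K = (\<Sum>k<m. penalty_norm C l (\<lambda>j. \<alpha> j k))"
  have le: "?W x - ?W z \<le> K * (\<Sum>k<m. \<bar>x k - z k\<bar>)" for x z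
  proof -
    have "?W x - ?W z \<le> penalty_norm C l (\<lambda>j. \<Sum>k<m. (x k - z k) * \<alpha> j k)"
      using bellman_le_add_norm[of "\<lambda>j. \<Sum>k<m. x k * \<alpha> j k" "\<lambda>j. \<Sum>k<m. z k * \<alpha> j k"]
      by (simp add: left_diff_distrib sum_subtractf)
    also have "\<dots> \<le> (\<Sum>k<m. \<bar>x k - z k\<bar> * penalty_norm C l (\<lambda>j. \<alpha> j k))"
      by (rule penalty_norm_sum[OF C_nonneg])
    also have "\<dots> \<le> (\<Sum>k<m. \<bar>x k - z k\<bar> * K)"
      unfolding K_def using penalty_norm_nonneg[OF C_nonneg]
      by (intro sum_mono mult_left_mono member_le_sum) auto
    finally show ?thesis by (simp add: sum_distrib_left mult.commute)
  qed
  have lip: "\<bar>?W x - ?W z\<bar> \<le> K * (\<Sum>k<m. \<bar>x k - z k\<bar>)" for x z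
  proof -
    have "(\<Sum>k<m. \<bar>z k - x k\<bar>) = (\<Sum>k<m. \<bar>x k - z k\<bar>)"
      by (simp add: abs_minus_commute)
    then show ?thesis using le[of x z] le[of z x] by (simp add: abs_le_iff)
  qed
  obtain \<delta> where "0 < \<delta>" and weak: "\<And>y s w k. (\<And>p. \<delta> \<le> p \<Longrightarrow> p \<le> 1 - \<delta> \<Longrightarrow>
        p * bellman (\<lambda>j. y j + (1 - p) * s * \<alpha> j k) + (1 - p) * bellman (\<lambda>j. y j - p * s * \<alpha> j k) < w)
      \<Longrightarrow> bellman y \<le> w"
    using bellman_weakly_convex by blast
  have "convex_on UNIV (\<lambda>t. ?W (x(k := t)))" if k: "k < m" for x k
  proof (rule convex_on_if_weakly_convex[OF _ \<open>0 < \<delta>\<close>])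
    have "\<bar>?W (x(k := t)) - ?W (x(k := t'))\<bar> \<le> K * \<bar>t - t'\<bar>" for t t'
    proof -
      have "(\<Sum>i<m. \<bar>(x(k := t)) i - (x(k := t')) i\<bar>) = (\<Sum>i<m. if i = k then \<bar>t - t'\<bar> else 0)"
        by (intro sum.cong) auto
      then show ?thesis using lip[of "x(k := t)" "x(k := t')"] k by simp
    qed
    then have "K-lipschitz_on UNIV (\<lambda>t. ?W (x(k := t)))"
      using penalty_norm_nonneg[OF C_nonneg]
      by (intro lipschitz_onI) (auto simp: dist_real_def K_def intro!: sum_nonneg)
    then show "continuous_on UNIV (\<lambda>t. ?W (x(k := t)))" by (rule lipschitz_on_continuous_on)
  next
    fix t s w :: real
    assume less: "\<And>p. \<delta> \<le> p \<Longrightarrow> p \<le> 1 - \<delta> \<Longrightarrow>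
      p * ?W (x(k := t + (1 - p) * s)) + (1 - p) * ?W (x(k := t - p * s)) < w"
    have upd: "(\<Sum>i<m. (x(k := t + q)) i * \<alpha> j i) = (\<Sum>i<m. (x(k := t)) i * \<alpha> j i) + q * \<alpha> j k" for q j
    proof -
      have "(\<Sum>i<m. (x(k := t + q)) i * \<alpha> j i) = (\<Sum>i<m. (x(k := t)) i * \<alpha> j i + (if i = k then q * \<alpha> j k else 0))"
        by (intro sum.cong) (auto simp: distrib_right)
      then show ?thesis using k by (simp add: sum.distrib)
    qed
    show "?W (x(k := t)) \<le> w"
    proof (rule weak)
      fix p assume "\<delta> \<le> p" "p \<le> 1 - \<delta>"
      from less[OF this] upd[of "(1 - p) * s"] upd[of "- (p * s)"]
      show "p * bellman (\<lambda>j. (\<Sum>i<m. (x(k := t)) i * \<alpha> j i) + (1 - p) * s * \<alpha> j k)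
        + (1 - p) * bellman (\<lambda>j. (\<Sum>i<m. (x(k := t)) i * \<alpha> j i) - p * s * \<alpha> j k) < w"
        by (simp del: fun_upd_apply)
    qed
  qed
  moreover have "?W (\<lambda>i. r * x i) = r * ?W x" if "0 < r" for r x
    using bellman_scale[OF that, of "\<lambda>j. \<Sum>k<m. x k * \<alpha> j k"] by (simp add: sum_distrib_left mult.assoc)
  ultimately have "hom_sep_convex m K ?W"
    using lip unfolding hom_sep_convex_def by blast
  then show ?thesis by (rule that)
qed

lemma linear_combination: "\<exists>c. \<forall>n. \<alpha> 1 n = (\<Sum>j=2..l. c j * \<alpha> j n)"
proof -
  obtain K where "hom_sep_convex m K (\<lambda>x. bellman (\<lambda>j. \<Sum>k<m. x k * \<alpha> j k))"
    using hom_sep_convex_bellman by blast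
  then obtain q where q: "\<And>x. (\<Sum>k<m. q k * x k) \<le> bellman (\<lambda>j. \<Sum>k<m. x k * \<alpha> j k)"
    using hom_sep_convex_linear_minorant by blast
  have "(\<Sum>k<m. x k * \<alpha> 1 k) = 0" if x: "\<forall>j\<in>{2..l}. (\<Sum>k<m. x k * \<alpha> j k) = 0" for x
  proof -
    \<comment> \<open>For such \<open>z\<close> the penalty reduces to its negative term. The left
      side is odd in \<open>z\<close> and the right side even, so using both \<open>x\<close> and
      \<open>-x\<close> forces the absolute value to be 0.\<close>
    have *: "(\<Sum>k<m. q k * z k) \<le> - \<bar>\<Sum>k<m. z k * \<alpha> 1 k\<bar>"
      if "\<forall>j\<in>{2..l}. (\<Sum>k<m. z k * \<alpha> j k) = 0" for z
      using order_trans[OF q bellman_le_penalty, of z] that by (simp add: penalty_def)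
    show ?thesis
      using *[OF x] *[of "\<lambda>k. - x k"] x by (simp add: sum_negf)
  qed
  then obtain c where c: "\<forall>k<m. \<alpha> 1 k = (\<Sum>j=2..l. c j * \<alpha> j k)"
    using linear_combination_of_kernel_subset[where J = "{2..l}" and m = m and \<alpha> = \<alpha> and \<beta> = "\<alpha> 1"] by auto
  have "\<alpha> 1 n = (\<Sum>j=2..l. c j * \<alpha> j n)" for n
  proof -
    have "\<alpha> j n = \<alpha> j (n mod m)" if "j \<in> {1..l}" for j
      using periodic_mult[OF that, of "n div m" "n mod m"] by simp
    then show ?thesis using c m l by simp
  qed
  then show ?thesis by blast
qed

end

section \<open>Sufficiency of linear dependence, and the common period\<close>

text \<open>The transform is linear in its coefficient sequence, so the triangle inequality applies
  at each time. The sum of all \<open>\<bar>c j\<bar>\<close> dominates each of them and gives one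
  constant for all terms.\<close>

lemma norm_transform_linear_combination:
  assumes f: "\<And>n. f n \<in> borel_measurable M" and "finite J"
    and c: "\<And>n. \<beta> n = (\<Sum>j\<in>J. c j * \<alpha> j n)"
  shows "martingale_L1_norm M (martingale_transform \<beta> f)
    \<le> ennreal (\<Sum>j\<in>J. \<bar>c j\<bar>) * (\<Sum>j\<in>J. martingale_L1_norm M (martingale_transform (\<alpha> j) f))"
  unfolding martingale_L1_norm_def[of _ "martingale_transform \<beta> f"]
proof (rule SUP_least)
  fix n
  have meas: "(\<lambda>x. ennreal \<bar>martingale_transform (\<alpha> j) f n x\<bar>) \<in> borel_measurable M" for j
    unfolding martingale_transform_def using f by measurable
  have "martingale_transform \<beta> f n x = (\<Sum>j\<in>J. c j * martingale_transform (\<alpha> j) f n x)" for x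
    unfolding martingale_transform_def c sum_distrib_left sum_distrib_right
    by (subst sum.swap) (simp add: mult.assoc)
  then have "\<bar>martingale_transform \<beta> f n x\<bar> \<le> (\<Sum>j\<in>J. \<bar>c j\<bar> * \<bar>martingale_transform (\<alpha> j) f n x\<bar>)" for x
    using sum_abs[of "\<lambda>j. c j * martingale_transform (\<alpha> j) f n x" J] by (simp add: abs_mult)
  then have "(\<integral>\<^sup>+x. ennreal \<bar>martingale_transform \<beta> f n x\<bar> \<partial>M)
      \<le> (\<integral>\<^sup>+x. (\<Sum>j\<in>J. ennreal \<bar>c j\<bar> * ennreal \<bar>martingale_transform (\<alpha> j) f n x\<bar>) \<partial>M)"
    by (intro nn_integral_mono) (simp add: sum_ennreal ennreal_leI flip: ennreal_mult)
  also have "\<dots> = (\<Sum>j\<in>J. ennreal \<bar>c j\<bar> * (\<integral>\<^sup>+x. ennreal \<bar>martingale_transform (\<alpha> j) f n x\<bar> \<partial>M))"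
    using meas by (simp add: nn_integral_sum nn_integral_cmult)
  also have "\<dots> \<le> (\<Sum>j\<in>J. ennreal (\<Sum>j\<in>J. \<bar>c j\<bar>) * martingale_L1_norm M (martingale_transform (\<alpha> j) f))"
  proof (intro sum_mono mult_mono ennreal_leI)
    fix j assume "j \<in> J"
    then show "\<bar>c j\<bar> \<le> (\<Sum>j\<in>J. \<bar>c j\<bar>)" using \<open>finite J\<close> by (intro member_le_sum) auto
    show "(\<integral>\<^sup>+x. ennreal \<bar>martingale_transform (\<alpha> j) f n x\<bar> \<partial>M) \<le> martingale_L1_norm M (martingale_transform (\<alpha> j) f)"
      unfolding martingale_L1_norm_def by (rule SUP_upper) simp
  qed auto
  finally show "(\<integral>\<^sup>+x. ennreal \<bar>martingale_transform \<beta> f n x\<bar> \<partial>M)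
    \<le> ennreal (\<Sum>j\<in>J. \<bar>c j\<bar>) * (\<Sum>j\<in>J. martingale_L1_norm M (martingale_transform (\<alpha> j) f))"
    by (simp add: sum_distrib_left)
qed

text \<open>The product of the individual periods is a multiple of each.\<close>

lemma common_period:
  assumes "finite J" "\<And>j. j \<in> J \<Longrightarrow> periodic_seq (\<alpha> j)"
  obtains m where "m \<ge> 1" "\<And>j n. j \<in> J \<Longrightarrow> \<alpha> j (n + m) = \<alpha> j n"
proof -
  obtain p where p: "\<And>j. j \<in> J \<Longrightarrow> p j \<ge> 1" "\<And>j n. j \<in> J \<Longrightarrow> \<alpha> j (n + p j) = \<alpha> j n"
    using assms(2) unfolding periodic_seq_def by metis
  have *: "\<alpha> j (n + q * p j) = \<alpha> j n" if "j \<in> J" for j n q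
  proof (induction q)
    case (Suc q)
    then show ?case using p(2)[OF that, of "n + q * p j"] by (simp add: ac_simps)
  qed simp
  show ?thesis
  proof (rule that)
    show "1 \<le> prod p J" using p(1) by (intro prod_ge_1) auto
    fix j n assume "j \<in> J"
    then have "prod p J = prod p (J - {j}) * p j"
      using \<open>finite J\<close> by (simp add: prod.remove[of J j] mult.commute)
    then show "\<alpha> j (n + prod p J) = \<alpha> j n" using *[OF \<open>j \<in> J\<close>] by simp
  qed
qed

theorem theorem5:
  fixes M :: "'a measure" and S :: "nat \<Rightarrow> 'a measure"
    and \<alpha> :: "nat \<Rightarrow> nat \<Rightarrow> real" and l :: nat
  assumes "standard_prob_space M"
    and "finite_filtration M S"
    and "differentiates_L1 M S"
    and "grows_uniformly M S"
    and "l \<ge> 1"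
    and "\<And>j. j \<in> {1..l} \<Longrightarrow> bounded (range (\<alpha> j))"
    and "\<And>j. j \<in> {1..l} \<Longrightarrow> periodic_seq (\<alpha> j)"
  shows "(\<exists>C::real. C \<ge> 0 \<and>
            (\<forall>f. L1_martingale M S f \<longrightarrow>
               martingale_L1_norm M (martingale_transform (\<alpha> 1) f)
                 \<le> ennreal C * (\<Sum>j=2..l. martingale_L1_norm M (martingale_transform (\<alpha> j) f))))
         \<longleftrightarrow> (\<exists>c :: nat \<Rightarrow> real. \<forall>n. \<alpha> 1 n = (\<Sum>j=2..l. c j * \<alpha> j n))"
    (is "?ineq \<longleftrightarrow> ?comb")
proof
  assume ?comb
  then obtain c where c: "\<And>n. \<alpha> 1 n = (\<Sum>j=2..l. c j * \<alpha> j n)" by blast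
  have "martingale_L1_norm M (martingale_transform (\<alpha> 1) f)
      \<le> ennreal (\<Sum>j=2..l. \<bar>c j\<bar>) * (\<Sum>j=2..l. martingale_L1_norm M (martingale_transform (\<alpha> j) f))"
    if "L1_martingale M S f" for f
    using that by (intro norm_transform_linear_combination c)
      (auto simp: L1_martingale_def martingale_def)
  then show ?ineq by (intro exI[of _ "\<Sum>j=2..l. \<bar>c j\<bar>"]) (auto intro: sum_nonneg)
next
  assume ?ineq
  then obtain C where C: "0 \<le> C" "\<And>f. L1_martingale M S f \<Longrightarrow>
      martingale_L1_norm M (martingale_transform (\<alpha> 1) f)
        \<le> ennreal C * (\<Sum>j=2..l. martingale_L1_norm M (martingale_transform (\<alpha> j) f))" by blast
  obtain m where m: "m \<ge> 1" "\<And>j n. j \<in> {1..l} \<Longrightarrow> \<alpha> j (n + m) = \<alpha> j n"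
    using common_period[of "{1..l}" \<alpha>] assms(7) by blast
  interpret prob_space M using assms(1) by (simp add: standard_prob_space_def)
  interpret transform_inequality M S C l m \<alpha>
    by unfold_locales (use assms C m in auto)
  show ?comb by (rule linear_combination)
qed

end
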